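(* The linear map $\phi:\mathbf{PBT}\to\mathbf{PBT}^*$ defined by $\phi(\mathbf{P}_T)=\mathbf{Q}'_T$ for every binary tree $T$ is a Hopf algebra isomorphism; that is, $\phi$ is bijective, $\phi(\mathbf{P}_{T'}\mathbf{P}_{T''})=\mathbf{Q}'_{T'}\mathbf{Q}'_{T''}$ and $(\phi\otimes\phi)(\Delta\mathbf{P}_T)=\Delta\mathbf{Q}'_T$ for all trees $T,T',T''$.
   Context: For a word $w$, $\mathrm{std}(w)$ is obtained by scanning $w$ left to right and labelling $1,2,\dots$ the occurrences of its smallest letter, then the next smallest, etc. For $\sigma\in S_n$, $\mathbf{F}_\sigma=\sum_{\mathrm{std}(w)=\sigma^{-1}}w$ in $\mathbb{K}\langle A\rangle$ ($A=\{1<2<\cdots\}$, $\mathbb{K}$ of characteristic $0$); $\mathbf{FQSym}$ is the Hopf algebra they span, with product given by the shifted shuffle and coproduct $\Delta\mathbf{F}_\sigma=\sum_{u\cdot v=\sigma}\mathbf{F}_{\mathrm{std}(u)}\otimes\mathbf{F}_{\mathrm{std}(v)}$. A binary tree is empty or a node with left and right subtrees. $\mathrm{bst}(w)$ is obtained by reading $w$ right to left and inserting each letter $x$: into an empty tree create a node labeled $x$; otherwise insert recursively into the left subtree if $x\le$ root label, into the right subtree if $x>$ root label. $\mathbf{P}_T=\sum_{\mathrm{shape}(\mathrm{bst}(\sigma))=T}\mathbf{F}_\sigma$ for an unlabeled tree $T$; $\mathbf{PBT}$ is the Hopf subalgebra of $\mathbf{FQSym}$ with basis $(\mathbf{P}_T)$,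 $\mathbf{PBT}^*$ its graded dual Hopf algebra and $(\mathbf{Q}_T)$ the basis of $\mathbf{PBT}^*$ dual to $(\mathbf{P}_T)$. For a tree $T$, $\mathbf{Q}'_T=\sum_{\sigma:\ \mathrm{shape}(\mathrm{bst}(\sigma))=T}\mathbf{Q}_{\mathrm{shape}(\mathrm{bst}(\sigma^{-1}))}$. *)

theory Defs
  imports Complex_Main "HOL-Library.Function_Algebras" "HOL-Library.Tree"
begin

text \<open>Vector spaces of scalar-valued functions; addition is pointwise, from
  \<^theory>\<open>HOL-Library.Function_Algebras\<close>.\<close>

definition fscale :: "'k::field \<Rightarrow> ('x \<Rightarrow> 'k) \<Rightarrow> 'x \<Rightarrow> 'k" where
  "fscale c f = (\<lambda>x. c * f x)"

global_interpretation fun_vs: vector_space "fscale :: 'k::field \<Rightarrow> ('x \<Rightarrow> 'k) \<Rightarrow> 'x \<Rightarrow> 'k"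
  by unfold_locales (auto simp: fscale_def fun_eq_iff algebra_simps)

definition linear_on ::
  "('k::field \<Rightarrow> 'v \<Rightarrow> 'v) \<Rightarrow> ('x \<Rightarrow> 'k) set \<Rightarrow> (('x \<Rightarrow> 'k) \<Rightarrow> 'v::ab_group_add) \<Rightarrow> bool" where
  "linear_on s V f \<longleftrightarrow>
     (\<forall>x\<in>V. \<forall>y\<in>V. f (x + y) = f x + f y) \<and> (\<forall>c. \<forall>x\<in>V. f (fscale c x) = s c (f x))"

text \<open>For a linearly independent family \<open>b\<close> (injective on \<open>I\<close>), \<open>coord I b x i\<close> is the
  coefficient of \<open>b i\<close> in \<open>x\<close>, and \<open>lin_ext s I b h\<close> is the linear map on the span of the
  family with \<open>b i \<mapsto> h i\<close>, where \<open>s\<close> is the scalar multiplication of the target space. Both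
  are \<open>0\<close> outside the span.\<close>

definition coord :: "'i set \<Rightarrow> ('i \<Rightarrow> 'x \<Rightarrow> 'k::field) \<Rightarrow> ('x \<Rightarrow> 'k) \<Rightarrow> 'i \<Rightarrow> 'k" where
  "coord I b x i = fun_vs.representation (b ` I) x (b i)"

definition lin_ext ::
  "('k::field \<Rightarrow> 'v \<Rightarrow> 'v) \<Rightarrow> 'i set \<Rightarrow> ('i \<Rightarrow> 'x \<Rightarrow> 'k) \<Rightarrow> ('i \<Rightarrow> 'v::ab_group_add) \<Rightarrow> ('x \<Rightarrow> 'k) \<Rightarrow> 'v"
  where
  "lin_ext s I b h x = (\<Sum>i \<in> {i \<in> I. coord I b x i \<noteq> 0}. s (coord I b x i) (h i))"

text \<open>The tensor product of two spaces of functions on \<open>X\<close> and \<open>Y\<close> is realised inside the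
  functions on \<open>X \<times> Y\<close>.\<close>

definition tensor :: "('x \<Rightarrow> 'k::field) \<Rightarrow> ('y \<Rightarrow> 'k) \<Rightarrow> 'x \<times> 'y \<Rightarrow> 'k" where
  "tensor f g = (\<lambda>(x, y). f x * g y)"

text \<open>A permutation of \<open>{1..n}\<close> is given by its word \<open>\<sigma>(1) \<dots> \<sigma>(n)\<close>.\<close>

definition is_perm :: "nat list \<Rightarrow> bool" where
  "is_perm \<sigma> \<longleftrightarrow> distinct \<sigma> \<and> set \<sigma> = {1..length \<sigma>}"

definition perm_inv :: "nat list \<Rightarrow> nat list" where
  "perm_inv \<sigma> = map (\<lambda>k. Suc (THE i. i < length \<sigma> \<and> \<sigma> ! i = k)) [1..<Suc (length \<sigma>)]"

text \<open>The label of position \<open>i\<close> is the number of positions labelled not later than \<open>i\<close>: those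
  with a smaller letter, and those up to \<open>i\<close> with the same letter.\<close>

definition std :: "nat list \<Rightarrow> nat list" where
  "std w = map (\<lambda>i. card {j. j < length w \<and> (w ! j < w ! i \<or> w ! j = w ! i \<and> j \<le> i)})
             [0..<length w]"

text \<open>A noncommutative series over the alphabet \<open>{1 < 2 < \<dots>}\<close> is a function from words to
  scalars, with the Cauchy product. On the series \<open>FF \<sigma>\<close> this product is the shifted shuffle.\<close>

type_synonym 'k series = "nat list \<Rightarrow> 'k"

definition series_one :: "'k::field series" where
  "series_one w = (if w = [] then 1 else 0)"

definition series_mult :: "'k::field series \<Rightarrow> 'k series \<Rightarrow> 'k series" (infixl "\<odot>" 70) where
  "(f \<odot> g) w = (\<Sum>(u, v) \<in> {(u, v). u @ v = w}. f u * g v)"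

definition FF :: "nat list \<Rightarrow> 'k::field series" where
  "FF \<sigma> w = (if (\<forall>a\<in>set w. 1 \<le> a) \<and> std w = perm_inv \<sigma> then 1 else 0)"

text \<open>The algebra \<open>FQSym\<close> is the span of the \<open>FF \<sigma>\<close>; its coproduct and counit are given on this basis.\<close>

definition coprod :: "'k::field series \<Rightarrow> nat list \<times> nat list \<Rightarrow> 'k" where
  "coprod = lin_ext fscale {\<sigma>. is_perm \<sigma>} FF
     (\<lambda>\<sigma>. \<Sum>(u, v) \<in> {(u, v). u @ v = \<sigma>}. tensor (FF (std u)) (FF (std v)))"

definition counit :: "'k::field series \<Rightarrow> 'k" where
  "counit = lin_ext (*) {\<sigma>. is_perm \<sigma>} FF (\<lambda>\<sigma>. if \<sigma> = [] then 1 else 0)"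

fun bst_insert :: "nat \<Rightarrow> nat tree \<Rightarrow> nat tree" where
  "bst_insert x Leaf = Node Leaf x Leaf"
| "bst_insert x (Node l a r) =
     (if x \<le> a then Node (bst_insert x l) a r else Node l a (bst_insert x r))"

text \<open>\<open>foldr\<close> inserts the last letter of the word first.\<close>

definition bst_of :: "nat list \<Rightarrow> nat tree" where
  "bst_of w = foldr bst_insert w Leaf"

definition shape :: "'a tree \<Rightarrow> unit tree" where
  "shape = map_tree (\<lambda>_. ())"

definition PP :: "unit tree \<Rightarrow> 'k::field series" where
  "PP T = (\<Sum>\<sigma> \<in> {\<sigma>. is_perm \<sigma> \<and> shape (bst_of \<sigma>) = T}. FF \<sigma>)"

definition PBT :: "'k::field series set" where
  "PBT = fun_vs.span (range PP)"

definition PBT_deg :: "nat \<Rightarrow> 'k::field series set" where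
  "PBT_deg n = fun_vs.span (PP ` {T. size T = n})"

definition PP2 :: "unit tree \<times> unit tree \<Rightarrow> nat list \<times> nat list \<Rightarrow> 'k::field" where
  "PP2 = (\<lambda>(S, T). tensor (PP S) (PP T))"

text \<open>Linear forms on \<open>PBT\<close> are set to \<open>0\<close> outside \<open>PBT\<close>. The graded dual consists of those
  that vanish on all but finitely many homogeneous components.\<close>

type_synonym 'k form = "'k series \<Rightarrow> 'k"

definition PBT_dual :: "'k::field form set" where
  "PBT_dual = {f. linear_on (*) PBT f \<and> (\<forall>x. x \<notin> PBT \<longrightarrow> f x = 0) \<and>
                  (\<exists>N. \<forall>n>N. \<forall>x\<in>PBT_deg n. f x = 0)}"

definition QQ :: "unit tree \<Rightarrow> 'k::field form" where
  "QQ T = (\<lambda>x. coord UNIV PP x T)"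

text \<open>The dual product is \<open>\<langle>f g, x\<rangle> = \<langle>f \<otimes> g, \<Delta> x\<rangle>\<close>, and the dual coproduct is
  \<open>\<langle>\<Delta> f, x \<otimes> y\<rangle> = \<langle>f, x y\<rangle>\<close>; elements of the tensor square of the dual are
  viewed as bilinear forms on \<open>PBT \<times> PBT\<close>, in accordance with \<open>tensor\<close>.\<close>

definition dual_mult :: "'k::field form \<Rightarrow> 'k form \<Rightarrow> 'k form" (infixl "\<star>" 70) where
  "(f \<star> g) x =
     (if x \<in> PBT then lin_ext (*) UNIV PP2 (\<lambda>(S, T). f (PP S) * g (PP T)) (coprod x) else 0)"

definition dual_one :: "'k::field form" where
  "dual_one x = (if x \<in> PBT then counit x else 0)"

definition dual_coprod :: "'k::field form \<Rightarrow> 'k series \<times> 'k series \<Rightarrow> 'k" where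
  "dual_coprod f = (\<lambda>(x, y). if x \<in> PBT \<and> y \<in> PBT then f (x \<odot> y) else 0)"

definition dual_counit :: "'k::field form \<Rightarrow> 'k" where
  "dual_counit f = f series_one"

definition QQ' :: "unit tree \<Rightarrow> 'k::field form" where
  "QQ' T = (\<Sum>\<sigma> \<in> {\<sigma>. is_perm \<sigma> \<and> shape (bst_of \<sigma>) = T}. QQ (shape (bst_of (perm_inv \<sigma>))))"

definition phi :: "'k::field series \<Rightarrow> 'k form" where
  "phi = lin_ext fscale UNIV PP QQ'"

definition tensor_map ::
  "('k::field series \<Rightarrow> 'k form) \<Rightarrow> ('k series \<Rightarrow> 'k form) \<Rightarrow>
   (nat list \<times> nat list \<Rightarrow> 'k) \<Rightarrow> 'k series \<times> 'k series \<Rightarrow> 'k" where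
  "tensor_map f g = lin_ext fscale UNIV PP2 (\<lambda>(S, T). tensor (f (PP S)) (g (PP T)))"

end

theory Submission
  imports Defs "HOL-Library.List_Lexorder" "HOL-Library.Multiset"
begin

text \<open>
  The coefficient of a word \<open>w\<close> in an element of \<open>PBT\<close> depends only on the tree of the inverse of
  \<open>std w\<close>, so \<open>QQ T\<close> is evaluation at a suitable word and \<open>QQ' T\<close> sends \<open>x\<close> to the sum of
  \<open>x \<sigma>\<close> over the class of \<open>T\<close>. Hence \<open>phi\<close> comes from the symmetric bilinear form
  \<open>\<Sum>\<sigma>. x (\<sigma>\<inverse>) y \<sigma>\<close>. For this form the product and the coproduct are adjoint, both being
  deconcatenation of words, which gives compatibility with the coproduct and, by symmetry, with
  the product. That \<open>PBT\<close> is closed under both operations is the fact that binary search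
  trees are compatible with restriction to intervals of letters and with concatenation.

  For bijectivity, consider the diagram of \<open>\<sigma>\<close>, with a cell in row \<open>i\<close> and column \<open>v\<close> if
  \<open>v\<close> is smaller than the \<open>i\<close>-th letter and occurs after it. The tree of \<open>\<sigma>\<close> is equivalent to
  the multiset of the rightmost cells of the rows, and the tree of the inverse to that of the
  lowest cells of the columns. Sort the former into a partition and the latter into the conjugate
  of one; the first partition is lexicographically at least as large as the second, with equality
  if \<open>\<sigma>\<close> avoids 132. Since each class contains a permutation avoiding 132, the matrix of
  \<open>phi\<close> is triangular up to a permutation of the columns.
\<close>

subsection \<open>Permutations and standardization\<close>

lemma perm_inv_eqI:
  assumes "length \<tau> = length \<sigma>" and "distinct \<sigma>"
    and "\<And>k. k < length \<sigma> \<Longrightarrow> \<exists>i<length \<sigma>. \<tau> ! k = Suc i \<and> \<sigma> ! i = Suc k"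
  shows "perm_inv \<sigma> = \<tau>"
proof (rule nth_equalityI)
  show "length (perm_inv \<sigma>) = length \<tau>" by (simp add: perm_inv_def assms(1) del: upt_Suc)
  fix k assume "k < length (perm_inv \<sigma>)"
  hence k: "k < length \<sigma>" by (simp add: perm_inv_def del: upt_Suc)
  then obtain i where i: "i < length \<sigma>" "\<tau> ! k = Suc i" "\<sigma> ! i = Suc k" using assms(3) by blast
  have "(THE i. i < length \<sigma> \<and> \<sigma> ! i = Suc k) = i"
    using i assms(2) by (intro the_equality) (simp, metis nth_eq_iff_index_eq)
  thus "perm_inv \<sigma> ! k = \<tau> ! k" using k i by (simp add: perm_inv_def del: upt_Suc)
qed

lemma length_perm_inv [simp]: "length (perm_inv \<sigma>) = length \<sigma>"
  by (simp add: perm_inv_def del: upt_Suc)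

lemma perm_inv_nth_ex:
  assumes "is_perm \<sigma>" "k < length \<sigma>"
  shows "\<exists>i<length \<sigma>. perm_inv \<sigma> ! k = Suc i \<and> \<sigma> ! i = Suc k"
proof -
  have "Suc k \<in> set \<sigma>" using assms by (auto simp: is_perm_def)
  then obtain i where i: "i < length \<sigma>" "\<sigma> ! i = Suc k" by (auto simp: in_set_conv_nth)
  have "(THE i. i < length \<sigma> \<and> \<sigma> ! i = Suc k) = i"
    using i assms by (intro the_equality) (simp, metis is_perm_def nth_eq_iff_index_eq)
  thus ?thesis using i assms by (auto simp: perm_inv_def simp del: upt_Suc)
qed

lemma perm_inv_nth:
  assumes "is_perm \<sigma>" "i < length \<sigma>"
  shows "perm_inv \<sigma> ! (\<sigma> ! i - 1) = Suc i" "\<sigma> ! i - 1 < length \<sigma>" "\<sigma> ! i \<ge> 1"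
proof -
  have "\<sigma> ! i \<in> {1..length \<sigma>}" using assms nth_mem[of i \<sigma>] by (auto simp: is_perm_def)
  thus k: "\<sigma> ! i - 1 < length \<sigma>" "\<sigma> ! i \<ge> 1" by auto
  obtain j where "j < length \<sigma>" "perm_inv \<sigma> ! (\<sigma> ! i - 1) = Suc j" "\<sigma> ! j = Suc (\<sigma> ! i - 1)"
    using perm_inv_nth_ex[OF assms(1) k(1)] by auto
  thus "perm_inv \<sigma> ! (\<sigma> ! i - 1) = Suc i"
    using k assms by (auto simp: is_perm_def nth_eq_iff_index_eq)
qed

lemma is_perm_perm_inv [simp]:
  assumes "is_perm \<sigma>" shows "is_perm (perm_inv \<sigma>)"
proof -
  have "set (perm_inv \<sigma>) = {1..length \<sigma>}"
  proof
    show "set (perm_inv \<sigma>) \<subseteq> {1..length \<sigma>}"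
      using perm_inv_nth_ex[OF assms] by (fastforce simp: in_set_conv_nth)
    show "{1..length \<sigma>} \<subseteq> set (perm_inv \<sigma>)"
    proof
      fix m assume m: "m \<in> {1..length \<sigma>}"
      have "perm_inv \<sigma> ! (\<sigma> ! (m - 1) - 1) = Suc (m - 1)" "\<sigma> ! (m - 1) - 1 < length \<sigma>"
        using perm_inv_nth[OF assms, of "m - 1"] m by auto
      thus "m \<in> set (perm_inv \<sigma>)" using m by (metis Suc_diff_1 atLeastAtMost_iff length_perm_inv nth_mem One_nat_def Suc_le_eq)
    qed
  qed
  thus ?thesis by (simp add: is_perm_def card_distinct)
qed

lemma perm_inv_perm_inv [simp]:
  assumes "is_perm \<sigma>" shows "perm_inv (perm_inv \<sigma>) = \<sigma>"
proof (rule perm_inv_eqI)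
  show "distinct (perm_inv \<sigma>)" using is_perm_perm_inv[OF assms] by (simp add: is_perm_def)
  fix k assume k: "k < length (perm_inv \<sigma>)"
  thus "\<exists>i<length (perm_inv \<sigma>). \<sigma> ! k = Suc i \<and> perm_inv \<sigma> ! i = Suc k"
    using perm_inv_nth[OF assms, of k] by (intro exI[of _ "\<sigma> ! k - 1"]) auto
qed simp

text \<open>The inverse of \<open>std w\<close>: its entry number k is the position that carries the
  label k. As \<open>sort_key\<close> is stable, equal letters are listed from left to right, just
  as they are labelled; \<open>Suc\<close> passes from list indices to positions.\<close>

definition inv_std :: "nat list \<Rightarrow> nat list" where
  "inv_std w = map Suc (sort_key (nth w) [0..<length w])"

lemma length_inv_std [simp]: "length (inv_std w) = length w"
  by (simp add: inv_std_def)

lemma length_std [simp]: "length (std w) = length w"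
  by (simp add: std_def)

text \<open>Stability of \<open>sort_key\<close>, phrased as a strict order with ties broken by
  position. The list is inserted from its end, and an inserted element goes in front of equal keys,
  so the smaller index comes first.\<close>

lemma sorted_wrt_sort_key:
  fixes xs :: "nat list"
  assumes "sorted_wrt (<) xs"
  shows "sorted_wrt (\<lambda>i j. f i < f j \<or> f i = f j \<and> i < j) (sort_key f xs)"
proof -
  have ins: "sorted_wrt (\<lambda>i j. f i < f j \<or> f i = f j \<and> i < j) (insort_key f x ys)"
    if "sorted_wrt (\<lambda>i j. f i < f j \<or> f i = f j \<and> i < j) ys" "\<forall>y\<in>set ys. x < y" for x :: nat and ys
    using that by (induction ys) (auto simp: set_insort_key)
  show ?thesis using assms by (induction xs) (auto intro!: ins)
qed

lemma std_nth_sort_key: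
  assumes "r < length w"
  shows "std w ! (sort_key (nth w) [0..<length w] ! r) = Suc r"
proof -
  define s where "s = sort_key (nth w) [0..<length w]"
  define R where "R = (\<lambda>i j. w ! i < w ! j \<or> w ! i = w ! j \<and> i < j)"
  have srt: "sorted_wrt R s" unfolding s_def R_def by (rule sorted_wrt_sort_key) simp
  have len: "length s = length w" and set: "set s = {..<length w}" and dist: "distinct s"
    by (auto simp: s_def)
  have i: "s ! r < length w" using nth_mem[of r s] assms len set by auto
  \<comment> \<open>The positions counted by the label are exactly the first \<open>Suc r\<close>
    entries of the sorted list of positions.\<close>
  have "{j. j < length w \<and> (w ! j < w ! (s ! r) \<or> w ! j = w ! (s ! r) \<and> j \<le> s ! r)} = (nth s) ` {..r}"
    (is "?L = ?R")
  proof
    show "?L \<subseteq> ?R"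
    proof
      fix j assume j: "j \<in> ?L"
      then obtain q where q: "q < length s" "s ! q = j"
        using set j in_set_conv_nth[of j s] by auto
      have "q \<le> r"
      proof (rule ccontr)
        assume "\<not> q \<le> r"
        hence "R (s ! r) j" using sorted_wrt_nth_less[OF srt, of r q] q by auto
        thus False using j by (auto simp: R_def)
      qed
      thus "j \<in> ?R" using q by auto
    qed
    show "?R \<subseteq> ?L"
    proof
      fix j assume "j \<in> ?R"
      then obtain q where q: "q \<le> r" "j = s ! q" by auto
      have "j < length w" using q assms set len nth_mem[of q s] by auto
      moreover have "q = r \<or> R j (s ! r)" 
        using sorted_wrt_nth_less[OF srt, of q r] q assms len by (cases "q = r") auto
      ultimately show "j \<in> ?L" using q by (auto simp: R_def)
    qed
  qed
  moreover have "card ((nth s) ` {..r}) = Suc r"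
    using dist assms len by (subst card_image) (auto simp: inj_on_def nth_eq_iff_index_eq)
  ultimately show ?thesis using i unfolding s_def[symmetric] by (simp add: std_def)
qed

lemma is_perm_std [simp]: "is_perm (std w)"
proof -
  define s where "s = sort_key (nth w) [0..<length w]"
  have "map (nth (std w)) s = [1..<Suc (length w)]"
    by (rule nth_equalityI) (auto simp: s_def std_nth_sort_key simp del: upt_Suc)
  moreover have "set s = {..<length w}" by (auto simp: s_def)
  ultimately have "set (std w) = {1..length w}"
    by (smt (verit) atLeastLessThanSuc_atLeastAtMost atLeast_upt length_std list.set_map map_nth set_upt)
  thus ?thesis by (simp add: is_perm_def card_distinct)
qed

lemma perm_inv_std: "perm_inv (std w) = inv_std w"
proof (rule perm_inv_eqI)
  show "distinct (std w)" using is_perm_std by (simp add: is_perm_def)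
  fix k assume k: "k < length (std w)"
  have "sort_key (nth w) [0..<length w] ! k < length w"
    using k nth_mem[of k "sort_key (nth w) [0..<length w]"] by auto
  thus "\<exists>i<length (std w). inv_std w ! k = Suc i \<and> std w ! i = Suc k"
    using k by (auto simp: inv_std_def std_nth_sort_key)
qed simp

lemma is_perm_inv_std [simp]: "is_perm (inv_std w)"
  by (metis is_perm_perm_inv is_perm_std perm_inv_std)

lemma std_eq_perm_inv_iff:
  assumes "is_perm \<sigma>" shows "std w = perm_inv \<sigma> \<longleftrightarrow> inv_std w = \<sigma>"
  by (metis assms is_perm_std perm_inv_perm_inv perm_inv_std)

lemma std_perm:
  assumes "is_perm \<sigma>" shows "std \<sigma> = \<sigma>"
proof (rule nth_equalityI)
  fix i assume "i < length (std \<sigma>)"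
  hence i: "i < length \<sigma>" by simp
  \<comment> \<open>In a permutation the letters up to a given letter form an initial interval, so
    the rank of a letter is the letter itself.\<close>
  have "nth \<sigma> ` {j. j < length \<sigma> \<and> (\<sigma> ! j < \<sigma> ! i \<or> \<sigma> ! j = \<sigma> ! i \<and> j \<le> i)} = {1..\<sigma> ! i}"
    (is "_ ` ?J = _")
  proof
    show "nth \<sigma> ` ?J \<subseteq> {1..\<sigma> ! i}"
      using perm_inv_nth(3)[OF assms] by (auto simp: less_imp_le) (metis i)
    show "{1..\<sigma> ! i} \<subseteq> nth \<sigma> ` ?J"
    proof
      fix m assume m: "m \<in> {1..\<sigma> ! i}"
      hence "m \<in> set \<sigma>" using assms perm_inv_nth(2)[OF assms i] by (auto simp: is_perm_def)
      then obtain j where j: "j < length \<sigma>" "\<sigma> ! j = m" by (auto simp: in_set_conv_nth)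
      have "j = i" if "m = \<sigma> ! i" using that j i assms by (auto simp: is_perm_def nth_eq_iff_index_eq)
      hence "j \<in> ?J" using j m by auto
      thus "m \<in> nth \<sigma> ` ?J" using j by auto
    qed
  qed
  moreover have "inj_on (nth \<sigma>) ?J" using assms by (auto simp: inj_on_def is_perm_def nth_eq_iff_index_eq)
  ultimately have "card ?J = \<sigma> ! i" 
    using card_image[of "nth \<sigma>" ?J] by simp
  thus "std \<sigma> ! i = \<sigma> ! i" using i by (simp add: std_def)
qed simp

lemma inv_std_perm: "is_perm \<sigma> \<Longrightarrow> inv_std \<sigma> = perm_inv \<sigma>"
  by (metis perm_inv_std std_perm)

lemma inv_std_std: "inv_std (std w) = inv_std w"
  by (metis is_perm_std perm_inv_std std_perm)

section \<open>Standardization of prefixes and suffixes\<close>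

lemma sort_key_cong_set:
  assumes "\<And>x. x \<in> set xs \<Longrightarrow> f x = g x"
  shows "sort_key f xs = sort_key g xs"
proof -
  have ins: "insort_key f x ys = insort_key g x ys"
    if "f x = g x" "\<And>y. y \<in> set ys \<Longrightarrow> f y = g y" for x ys
    using that by (induction ys) auto
  show ?thesis using assms by (induction xs) (auto intro!: ins)
qed

lemma sort_key_map: "sort_key f (map g xs) = map g (sort_key (\<lambda>x. f (g x)) xs)"
proof -
  have ins: "insort_key f (g x) (map g ys) = map g (insort_key (\<lambda>x. f (g x)) x ys)" for x ys
    by (induction ys) auto
  show ?thesis by (induction xs) (auto simp: ins)
qed

lemma filter_upt_less: "k \<le> n \<Longrightarrow> filter (\<lambda>i. i < k) [0..<n] = [0..<k]"
proof (induction n)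
  case (Suc n)
  thus ?case by (cases "k = Suc n") (auto simp: filter_id_conv)
qed simp

lemma filter_upt_ge: "k \<le> n \<Longrightarrow> filter (\<lambda>i. k \<le> i) [0..<n] = [k..<n]"
proof (induction n)
  case (Suc n)
  thus ?case by (cases "k = Suc n") (auto simp: filter_empty_conv)
qed simp

text \<open>Stable sorting commutes with filtering. Cutting a word therefore becomes, for the
  inverse of its standardization, restriction to an interval of letters.\<close>

lemma inv_std_take:
  assumes "k \<le> length w"
  shows "inv_std (take k w) = filter (\<lambda>i. i \<le> k) (inv_std w)"
proof -
  have "sort_key (nth (take k w)) [0..<k] = sort_key (nth w) [0..<k]"
    by (rule sort_key_cong_set) auto
  also have "[0..<k] = filter (\<lambda>i. i < k) [0..<length w]"
    by (rule filter_upt_less[OF assms, symmetric])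
  also have "sort_key (nth w) \<dots> = filter (\<lambda>i. i < k) (sort_key (nth w) [0..<length w])"
    by (simp add: filter_sort)
  finally have "sort_key (nth (take k w)) [0..<k] = \<dots>"
    using assms by (simp add: filter_upt_less)
  thus ?thesis using assms
    by (simp add: inv_std_def filter_map o_def Suc_le_eq min_absorb2)
qed

lemma inv_std_drop:
  assumes "k \<le> length w"
  shows "map (\<lambda>i. i + k) (inv_std (drop k w)) = filter (\<lambda>i. i > k) (inv_std w)"
proof -
  have "map (\<lambda>i. i + k) (sort_key (nth (drop k w)) [0..<length w - k]) =
        map (\<lambda>i. i + k) (sort_key (\<lambda>i. w ! (i + k)) [0..<length w - k])"
    using assms by (intro arg_cong[of _ _ "map _"] sort_key_cong_set) (auto simp: add.commute)
  also have "\<dots> = sort_key (nth w) (map (\<lambda>i. i + k) [0..<length w - k])"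
    by (simp add: sort_key_map)
  also have "map (\<lambda>i. i + k) [0..<length w - k] = filter (\<lambda>i. i \<ge> k) [0..<length w]"
    using assms by (simp add: map_add_upt filter_upt_ge)
  also have "sort_key (nth w) \<dots> = filter (\<lambda>i. i \<ge> k) (sort_key (nth w) [0..<length w])"
    by (simp add: filter_sort)
  finally have "map Suc (map (\<lambda>i. i + k) (sort_key (nth (drop k w)) [0..<length w - k])) =
    map Suc (filter (\<lambda>i. i \<ge> k) (sort_key (nth w) [0..<length w]))" by simp
  thus ?thesis by (simp add: inv_std_def filter_map o_def less_Suc_eq_le)
qed

subsection \<open>Binary search trees\<close>

lemma shape_simps [simp]: "shape Leaf = Leaf" "shape (Node l a r) = Node (shape l) () (shape r)"
  by (simp_all add: shape_def)

lemma size_shape [simp]: "size (shape t) = size t"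
  by (simp add: shape_def)

lemma shape_map_tree [simp]: "shape (map_tree f t) = shape t"
  by (induction t) auto

lemma shape_inorder_unique:
  "shape s = shape t \<Longrightarrow> inorder s = inorder t \<Longrightarrow> s = t"
proof (induction s arbitrary: t)
  case Leaf
  thus ?case by (cases t) auto
next
  case (Node l a r)
  then obtain l' b r' where t: "t = Node l' b r'" by (cases t) auto
  \<comment> \<open>Equal sizes of the left subtrees force the two inorder lists to split at the
    same place.\<close>
  have "size l = size l'" using Node.prems t by (metis shape_simps(2) size_shape tree.inject)
  hence "length (inorder l) = length (inorder l')" by simp
  thus ?case using Node t by auto
qed

lemma bst_of_simps [simp]: "bst_of [] = Leaf" "bst_of (x # w) = bst_insert x (bst_of w)"
  by (simp_all add: bst_of_def)

lemma insort_append: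
  "sorted (xs @ a # ys) \<Longrightarrow>
   insort x (xs @ a # ys) = (if x \<le> a then insort x xs @ a # ys else xs @ a # insort x ys)"
  by (induction xs) auto

lemma inorder_bst_insert:
  "sorted (inorder t) \<Longrightarrow> inorder (bst_insert x t) = insort x (inorder t)"
  by (induction t) (auto simp: insort_append sorted_append)

lemma inorder_bst_of: "inorder (bst_of w) = sort w"
  by (induction w) (auto simp: inorder_bst_insert)

lemma size_bst_of [simp]: "size (bst_of w) = length w"
  by (metis inorder_bst_of length_inorder length_sort)

lemma set_bst_of [simp]: "set_tree (bst_of w) = set w"
  by (metis inorder_bst_of set_inorder set_sort)

lemma sort_perm: "is_perm \<sigma> \<Longrightarrow> sort \<sigma> = [1..<Suc (length \<sigma>)]"
  by (rule sorted_distinct_set_unique)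
    (simp_all add: is_perm_def atLeastLessThanSuc_atLeastAtMost del: upt_Suc)

text \<open>The labels read in inorder are 1 to n, hence determined by the shape. This allows
  labelled trees to be used where only shapes are known to agree.\<close>

lemma bst_of_perm_eq:
  assumes "is_perm \<sigma>" "is_perm \<tau>" "shape (bst_of \<sigma>) = shape (bst_of \<tau>)"
  shows "bst_of \<sigma> = bst_of \<tau>"
proof (rule shape_inorder_unique)
  have "length \<sigma> = length \<tau>" using assms(3) by (metis size_bst_of size_shape)
  thus "inorder (bst_of \<sigma>) = inorder (bst_of \<tau>)" using assms by (simp add: inorder_bst_of sort_perm)
qed (use assms in auto)

lemma bst_of_map:
  assumes "strict_mono_on (set w) f"
  shows "bst_of (map f w) = map_tree f (bst_of w)"
proof -
  have ins: "bst_insert (f x) (map_tree f t) = map_tree f (bst_insert x t)"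
    if "strict_mono_on (insert x (set_tree t)) f" for x t
    using that
  proof (induction t)
    case (Node l a r)
    have "strict_mono_on (insert x (set_tree l)) f" "strict_mono_on (insert x (set_tree r)) f"
      using Node.prems by (auto simp: strict_mono_on_def)
    moreover have "f x \<le> f a \<longleftrightarrow> x \<le> a"
      using Node.prems by (intro strict_mono_on_less_eq) auto
    ultimately show ?case using Node.IH by simp
  qed simp
  show ?thesis using assms
  proof (induction w)
    case (Cons x w)
    have "strict_mono_on (set w) f" using Cons.prems by (auto simp: strict_mono_on_def)
    thus ?case using Cons ins[of x "bst_of w"] by simp
  qed simp
qed

section \<open>Restriction of search trees to intervals of letters, and concatenation\<close>

fun trunc_le :: "nat \<Rightarrow> nat tree \<Rightarrow> nat tree" where
  "trunc_le k Leaf = Leaf"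
| "trunc_le k (Node l a r) = (if a \<le> k then Node l a (trunc_le k r) else trunc_le k l)"

fun trunc_gt :: "nat \<Rightarrow> nat tree \<Rightarrow> nat tree" where
  "trunc_gt k Leaf = Leaf"
| "trunc_gt k (Node l a r) = (if a \<le> k then trunc_gt k r else Node (trunc_gt k l) a r)"

lemma trunc_le_insert:
  "trunc_le k (bst_insert x t) = (if x \<le> k then bst_insert x (trunc_le k t) else trunc_le k t)"
  by (induction t) auto

lemma trunc_gt_insert:
  "trunc_gt k (bst_insert x t) = (if x \<le> k then trunc_gt k t else bst_insert x (trunc_gt k t))"
  by (induction t) auto

lemma bst_of_filter_le: "bst_of (filter (\<lambda>x. x \<le> k) w) = trunc_le k (bst_of w)"
  by (induction w) (auto simp: trunc_le_insert)

lemma bst_of_filter_gt: "bst_of (filter (\<lambda>x. x > k) w) = trunc_gt k (bst_of w)"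
  by (induction w) (auto simp: trunc_gt_insert)

text \<open>The result of inserting into \<open>t\<close> a word with tree \<open>s\<close>: each
  empty subtree of \<open>t\<close> receives the restriction of \<open>s\<close> to the interval of
  labels that is routed there.\<close>

fun plug :: "nat tree \<Rightarrow> nat tree \<Rightarrow> nat tree" where
  "plug Leaf s = s"
| "plug (Node l a r) s = Node (plug l (trunc_le a s)) a (plug r (trunc_gt a s))"

lemma plug_Leaf [simp]: "plug t Leaf = t"
  by (induction t) auto

lemma plug_insert: "plug t (bst_insert x s) = bst_insert x (plug t s)"
  by (induction t arbitrary: s) (auto simp: trunc_le_insert trunc_gt_insert)

lemma bst_of_append: "bst_of (u @ v) = plug (bst_of v) (bst_of u)"
  by (induction u) (auto simp: plug_insert)

text \<open>The series \<open>PP T\<close> is the sum of the words \<open>w\<close> with \<open>word_tree w = T\<close>.\<close>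

definition word_tree :: "nat list \<Rightarrow> unit tree" where
  "word_tree w = shape (bst_of (inv_std w))"

lemma size_word_tree [simp]: "size (word_tree w) = length w"
  by (simp add: word_tree_def)

lemma word_tree_perm: "is_perm \<sigma> \<Longrightarrow> word_tree \<sigma> = shape (bst_of (perm_inv \<sigma>))"
  by (simp add: word_tree_def inv_std_perm)

lemma word_tree_perm_inv: "is_perm \<sigma> \<Longrightarrow> word_tree (perm_inv \<sigma>) = shape (bst_of \<sigma>)"
  by (simp add: word_tree_perm)

lemma word_tree_std: "word_tree (std w) = word_tree w"
  by (simp add: word_tree_def inv_std_std)

lemma word_tree_eqD:
  assumes "word_tree w = word_tree w'"
  shows "bst_of (inv_std w) = bst_of (inv_std w')" "length w = length w'"
  using assms bst_of_perm_eq[of "inv_std w" "inv_std w'"] size_word_tree[of w] size_word_tree[of w']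
  by (auto simp: word_tree_def)

text \<open>A prefix restricts the inverse standardization to small letters, which truncates its
  search tree. With the analogous fact for suffixes this makes \<open>PBT\<close> closed under the
  product.\<close>

lemma word_tree_take_cong:
  assumes "word_tree w = word_tree w'"
  shows "word_tree (take k w) = word_tree (take k w')"
proof (cases "k \<le> length w")
  case True
  thus ?thesis using word_tree_eqD[OF assms]
    by (simp add: word_tree_def inv_std_take bst_of_filter_le)
next
  case False
  thus ?thesis using assms word_tree_eqD(2)[OF assms] by simp
qed

text \<open>The shift by \<open>k\<close> that relates the suffix to the filtered word is strictly
  increasing, so it leaves the shape unchanged.\<close>

lemma word_tree_drop:
  assumes "k \<le> length w"
  shows "word_tree (drop k w) = shape (trunc_gt k (bst_of (inv_std w)))"
proof -
  have "strict_mono_on (set (inv_std (drop k w))) (\<lambda>i. i + k)" by (auto simp: strict_mono_on_def)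
  hence "word_tree (drop k w) = shape (bst_of (map (\<lambda>i. i + k) (inv_std (drop k w))))"
    by (simp add: word_tree_def bst_of_map)
  thus ?thesis using assms by (simp add: inv_std_drop bst_of_filter_gt)
qed

lemma word_tree_drop_cong:
  assumes "word_tree w = word_tree w'"
  shows "word_tree (drop k w) = word_tree (drop k w')"
proof (cases "k \<le> length w")
  case True
  thus ?thesis using word_tree_eqD[OF assms] by (simp add: word_tree_drop)
next
  case False
  thus ?thesis using assms word_tree_eqD(2)[OF assms] by simp
qed

subsection \<open>Canonical permutations\<close>

text \<open>The permutation of the class of \<open>T\<close> that avoids the pattern 132.\<close>

fun canon :: "unit tree \<Rightarrow> nat list" where
  "canon Leaf = []"
| "canon (Node l a r) = map (\<lambda>i. i + Suc (size l)) (canon r) @ canon l @ [Suc (size l)]"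

lemma length_canon [simp]: "length (canon T) = size T"
  by (induction T) auto

lemma is_perm_canon [simp]: "is_perm (canon T)"
proof (induction T)
  case (Node l a r)
  have "(\<lambda>i. i + Suc (size l)) ` {1..size r} = {Suc (Suc (size l))..size r + Suc (size l)}"
    using image_add_atLeastAtMost'[of "Suc (size l)" 1 "size r"] by simp
  thus ?case using Node by (auto simp: is_perm_def distinct_map inj_on_def)
qed (simp add: is_perm_def)

lemma shape_bst_of_canon [simp]: "shape (bst_of (canon T)) = T"
proof (induction T)
  case (Node l a r)
  let ?k = "Suc (size l)"
  let ?r = "map (\<lambda>i. i + ?k) (canon r)"
  have l: "set (canon l) = {1..size l}" using is_perm_canon[of l] by (simp add: is_perm_def)
  \<comment> \<open>Once the root is present, each letter is routed by comparison with it alone, so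
    the two sides are built independently.\<close>
  have split: "foldr bst_insert w (Node s b t) =
    Node (foldr bst_insert (filter (\<lambda>x. x \<le> b) w) s) b (foldr bst_insert (filter (\<lambda>x. x > b) w) t)"
    for w s b t by (induction w) auto
  have "bst_of (canon (Node l a r)) = foldr bst_insert (?r @ canon l) (Node Leaf ?k Leaf)"
    by (simp add: bst_of_def)
  also have "\<dots> = Node (bst_of (filter (\<lambda>x. x \<le> ?k) (?r @ canon l))) ?k
                      (bst_of (filter (\<lambda>x. x > ?k) (?r @ canon l)))"
    by (simp only: split bst_of_def)
  also have "filter (\<lambda>x. x \<le> ?k) (?r @ canon l) = canon l"
    using l is_perm_canon[of r] by (auto simp: filter_empty_conv filter_id_conv is_perm_def)
  also have "filter (\<lambda>x. x > ?k) (?r @ canon l) = ?r"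
    using l is_perm_canon[of r] by (auto simp: filter_empty_conv filter_id_conv is_perm_def)
  also have "bst_of ?r = map_tree (\<lambda>i. i + ?k) (bst_of (canon r))"
    by (rule bst_of_map) (auto simp: strict_mono_on_def)
  finally show ?case using Node by simp
qed simp

subsection \<open>Families with dual points\<close>

lemma sum_fun_apply: "(\<Sum>i\<in>A. f i) x = (\<Sum>i\<in>A. f i x)"
  for f :: "'i \<Rightarrow> 'x \<Rightarrow> 'v::comm_monoid_add"
  by (induction A rule: infinite_finite_induct) auto

lemma fscale_apply [simp]: "fscale c f x = c * f x"
  by (simp add: fscale_def)

text \<open>A family of functions that is dual to a family of points is independent, and its
  coordinates are evaluations. This applies to \<open>FF\<close>, \<open>PP\<close> and \<open>PP2\<close> alike.\<close>

locale dual_points =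
  fixes I :: "'i set" and b :: "'i \<Rightarrow> 'x \<Rightarrow> 'k::field" and e :: "'i \<Rightarrow> 'x"
  assumes dual: "i \<in> I \<Longrightarrow> j \<in> I \<Longrightarrow> b i (e j) = (if i = j then 1 else 0)"
begin

lemma inj: "inj_on b I"
  by (rule inj_onI) (metis dual zero_neq_one)

lemma independent: "fun_vs.independent (b ` I)"
proof
  assume "fun_vs.dependent (b ` I)"
  then obtain S u v where S: "finite S" "S \<subseteq> b ` I" "(\<Sum>v\<in>S. fscale (u v) v) = 0" "v \<in> S" "u v \<noteq> 0"
    unfolding fun_vs.dependent_explicit by auto
  obtain i where i: "i \<in> I" "v = b i" using S by auto
  have "w (e i) = (if w = v then 1 else 0)" if "w \<in> S" for w
    using that S(2) i dual inj by (auto simp: inj_on_def)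
  hence "(\<Sum>v\<in>S. fscale (u v) v) (e i) = (\<Sum>w\<in>S. u w * (if w = v then 1 else 0))"
    unfolding sum_fun_apply by (intro sum.cong) auto
  also have "\<dots> = u v" using S by (simp add: if_distrib cong: if_cong)
  finally show False using S by simp
qed

lemma coord_eq:
  assumes "x \<in> fun_vs.span (b ` I)" "i \<in> I"
  shows "coord I b x i = x (e i)"
proof -
  let ?r = "fun_vs.representation (b ` I) x"
  have fin: "finite {v. ?r v \<noteq> 0}" by (rule fun_vs.finite_representation)
  have "x = (\<Sum>v | ?r v \<noteq> 0. fscale (?r v) v)"
    using fun_vs.sum_nonzero_representation_eq[OF independent assms(1)] by simp
  hence "x (e i) = (\<Sum>v | ?r v \<noteq> 0. ?r v * v (e i))" by (metis (no_types, lifting) fscale_apply sum.cong sum_fun_apply)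
  also have "\<dots> = (\<Sum>v | ?r v \<noteq> 0. if v = b i then ?r v else 0)"
  proof (rule sum.cong)
    fix v assume "v \<in> {v. ?r v \<noteq> 0}"
    hence "v \<in> b ` I" using fun_vs.representation_ne_zero by auto
    then obtain j where "j \<in> I" "v = b j" by auto
    thus "?r v * v (e i) = (if v = b i then ?r v else 0)"
      using dual assms(2) inj by (auto simp: inj_on_def)
  qed simp
  also have "\<dots> = ?r (b i)" using fin by simp
  finally show ?thesis by (simp add: coord_def)
qed

lemma coord_outside: "x \<notin> fun_vs.span (b ` I) \<Longrightarrow> coord I b x i = 0"
  by (simp add: coord_def fun_vs.representation_def)

lemma finite_coord: "finite {i \<in> I. coord I b x i \<noteq> 0}"
proof -
  have "b ` {i \<in> I. coord I b x i \<noteq> 0} \<subseteq> {v. fun_vs.representation (b ` I) x v \<noteq> 0}"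
    by (auto simp: coord_def)
  hence "finite (b ` {i \<in> I. coord I b x i \<noteq> 0})"
    using fun_vs.finite_representation finite_subset by blast
  thus ?thesis by (rule finite_imageD) (rule inj_on_subset[OF inj], auto)
qed

text \<open>Any finite index set containing the support will do, so that several vectors can be
  expanded over one common set.\<close>

lemma lin_ext_eq:
  assumes "x \<in> fun_vs.span (b ` I)" "finite A" "A \<subseteq> I" "\<And>i. i \<in> I - A \<Longrightarrow> x (e i) = 0"
    and "\<And>v. s 0 v = 0"
  shows "lin_ext s I b h x = (\<Sum>i\<in>A. s (x (e i)) (h i))"
proof -
  have "lin_ext s I b h x = (\<Sum>i | i \<in> I \<and> x (e i) \<noteq> 0. s (x (e i)) (h i))"
    unfolding lin_ext_def using assms(1) by (intro sum.cong) (auto simp: coord_eq)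
  also have "\<dots> = (\<Sum>i\<in>A. s (x (e i)) (h i))"
    using assms by (intro sum.mono_neutral_left) auto
  finally show ?thesis .
qed

lemma finite_support: "x \<in> fun_vs.span (b ` I) \<Longrightarrow> finite {i \<in> I. x (e i) \<noteq> 0}"
  using finite_coord[of x] by (simp add: coord_eq cong: conj_cong)

lemma base_in_span: "i \<in> I \<Longrightarrow> b i \<in> fun_vs.span (b ` I)"
  by (simp add: fun_vs.span_base)

lemma lin_ext_base:
  assumes "i \<in> I" "\<And>v. s 0 v = 0" "\<And>v. s 1 v = v"
  shows "lin_ext s I b h (b i) = h i"
  using assms by (subst lin_ext_eq[of _ "{i}"]) (auto simp: base_in_span dual)

lemma lin_ext_add:
  assumes "x \<in> fun_vs.span (b ` I)" "y \<in> fun_vs.span (b ` I)"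
    and "\<And>v. s 0 v = 0" "\<And>c d v. s (c + d) v = s c v + s d v"
  shows "lin_ext s I b h (x + y) = lin_ext s I b h x + lin_ext s I b h y"
proof -
  define A where "A = {i \<in> I. x (e i) \<noteq> 0} \<union> {i \<in> I. y (e i) \<noteq> 0}"
  have A: "finite A" "A \<subseteq> I" "\<And>i. i \<in> I - A \<Longrightarrow> x (e i) = 0" "\<And>i. i \<in> I - A \<Longrightarrow> y (e i) = 0"
    using assms(1,2) by (auto simp: finite_support A_def)
  moreover have "x + y \<in> fun_vs.span (b ` I)" using assms by (intro fun_vs.span_add)
  ultimately have "lin_ext s I b h z = (\<Sum>i\<in>A. s (z (e i)) (h i))" if "z \<in> {x, y, x + y}" for z
    using assms(1-3) that by (intro lin_ext_eq) auto
  thus ?thesis using assms(4) by (simp add: sum.distrib)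
qed

lemma lin_ext_scale:
  assumes "x \<in> fun_vs.span (b ` I)"
    and "\<And>v. s 0 v = 0" "\<And>c v w. s c (v + w) = s c v + s c w" "\<And>c d v. s (c * d) v = s c (s d v)"
  shows "lin_ext s I b h (fscale c x) = s c (lin_ext s I b h x)"
proof -
  define A where "A = {i \<in> I. x (e i) \<noteq> 0}"
  have A: "finite A" "A \<subseteq> I" "\<And>i. i \<in> I - A \<Longrightarrow> x (e i) = 0"
    using assms(1) by (auto simp: finite_support A_def)
  \<comment> \<open>Vanishing of \<open>s c\<close> at 0 follows from the compatibility with
    multiplication of scalars, since 0 is \<open>s 0 0\<close>.\<close>
  have "s c 0 = s c (s 0 0)" by (simp add: assms(2))
  also have "\<dots> = 0" using assms(4)[of c 0 0] assms(2) by simp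
  finally have sc0: "s c 0 = 0" .
  have sc: "s c (\<Sum>i\<in>B. f i) = (\<Sum>i\<in>B. s c (f i))" for f and B :: "'i set"
    by (induction B rule: infinite_finite_induct) (auto simp: assms(3) sc0)
  have "fscale c x \<in> fun_vs.span (b ` I)" using assms by (intro fun_vs.span_scale)
  hence "lin_ext s I b h z = (\<Sum>i\<in>A. s (z (e i)) (h i))" if "z \<in> {x, fscale c x}" for z
    using A assms(1,2) that by (intro lin_ext_eq) auto
  thus ?thesis by (simp add: sc assms(4))
qed

end

subsection \<open>The algebra of planar binary trees as a space of functions on words\<close>

abbreviation tree_class :: "unit tree \<Rightarrow> nat list set" where
  "tree_class T \<equiv> {\<sigma>. is_perm \<sigma> \<and> shape (bst_of \<sigma>) = T}"

abbreviation pos_word :: "nat list \<Rightarrow> bool" where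
  "pos_word w \<equiv> 0 \<notin> set w"

text \<open>The test word for \<open>T\<close>: among all \<open>PP S\<close> only
  \<open>PP T\<close> is nonzero there, so evaluation at it reads off the coefficient of
  \<open>PP T\<close>.\<close>

abbreviation tree_word :: "unit tree \<Rightarrow> nat list" where
  "tree_word T \<equiv> perm_inv (canon T)"

lemma pos_word_perm: "is_perm \<sigma> \<Longrightarrow> pos_word \<sigma>"
  by (simp add: is_perm_def)

lemma pos_word_perm_inv: "is_perm \<sigma> \<Longrightarrow> pos_word (perm_inv \<sigma>)"
  by (rule pos_word_perm) simp

lemma word_tree_tree_word [simp]: "word_tree (tree_word T) = T"
  by (simp add: word_tree_perm_inv)

lemma finite_perms: "finite {\<sigma>. is_perm \<sigma> \<and> length \<sigma> \<le> N}"
proof (rule finite_subset)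
  show "{\<sigma>. is_perm \<sigma> \<and> length \<sigma> \<le> N} \<subseteq> {\<sigma>. set \<sigma> \<subseteq> {1..N} \<and> length \<sigma> \<le> N}"
    by (auto simp: is_perm_def)
qed (rule finite_lists_length_le, simp)

lemma tree_class_length: "\<sigma> \<in> tree_class T \<Longrightarrow> length \<sigma> = size T"
  by auto

lemma finite_tree_class [simp]: "finite (tree_class T)"
  by (rule finite_subset[OF _ finite_perms[of "size T"]]) auto

lemma finite_trees: "finite {T :: unit tree. size T \<le> N}"
proof (rule finite_subset)
  show "{T :: unit tree. size T \<le> N} \<subseteq> (\<lambda>\<sigma>. shape (bst_of \<sigma>)) ` {\<sigma>. is_perm \<sigma> \<and> length \<sigma> \<le> N}"
  proof
    fix T :: "unit tree" assume "T \<in> {T. size T \<le> N}"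
    thus "T \<in> (\<lambda>\<sigma>. shape (bst_of \<sigma>)) ` {\<sigma>. is_perm \<sigma> \<and> length \<sigma> \<le> N}"
      by (intro image_eqI[of _ _ "canon T"]) auto
  qed
qed (intro finite_imageI finite_perms)

lemma FF_apply:
  assumes "is_perm \<sigma>"
  shows "FF \<sigma> w = (if pos_word w \<and> inv_std w = \<sigma> then 1 else 0)"
proof -
  have "pos_word w \<longleftrightarrow> (\<forall>a\<in>set w. 1 \<le> a)" by (metis less_one not_le)
  thus ?thesis using std_eq_perm_inv_iff[OF assms, of w] by (simp add: FF_def)
qed

text \<open>A positive word occurs in exactly one \<open>FF \<sigma>\<close>, the one with
  \<open>\<sigma> = inv_std w\<close>, so at most one summand survives.\<close>

lemma PP_apply: "PP T w = (if pos_word w \<and> word_tree w = T then 1 else 0)"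
proof -
  have "PP T w = (\<Sum>\<sigma>\<in>tree_class T. if pos_word w \<and> inv_std w = \<sigma> then 1 else 0)"
    unfolding PP_def sum_fun_apply by (intro sum.cong) (auto simp: FF_apply)
  also have "\<dots> = (if pos_word w \<and> word_tree w = T then 1 else 0)"
    by (cases "pos_word w") (simp_all add: word_tree_def)
  finally show ?thesis .
qed

interpretation FFd: dual_points "{\<sigma>. is_perm \<sigma>}" "FF :: nat list \<Rightarrow> 'k::field series" perm_inv
  by unfold_locales (use pos_word_perm_inv in \<open>auto simp: FF_apply inv_std_perm\<close>)

interpretation PPd: dual_points UNIV "PP :: unit tree \<Rightarrow> 'k::field series" tree_word
  by unfold_locales (use pos_word_perm_inv[OF is_perm_canon] in \<open>auto simp: PP_apply\<close>)

interpretation PP2d: dual_points UNIV "PP2 :: _ \<Rightarrow> _ \<Rightarrow> 'k::field" "\<lambda>(S, T). (tree_word S, tree_word T)"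
  by unfold_locales (auto simp: PP2_def tensor_def PPd.dual split: if_splits)

lemma word_tree_expand:
  assumes "\<And>w. \<not> pos_word w \<Longrightarrow> x w = 0"
    and "\<And>w w'. pos_word w \<Longrightarrow> pos_word w' \<Longrightarrow> word_tree w = word_tree w' \<Longrightarrow> x w = x w'"
    and "\<And>w. length w > N \<Longrightarrow> x w = 0"
  shows "x = (\<Sum>T | size T \<le> N. fscale (x (tree_word T)) (PP T))"
proof
  fix w
  show "x w = (\<Sum>T | size T \<le> N. fscale (x (tree_word T)) (PP T)) w"
  proof (cases "pos_word w \<and> length w \<le> N")
    case True
    have "(\<Sum>T | size T \<le> N. fscale (x (tree_word T)) (PP T)) w =
          (\<Sum>T | size T \<le> N. if T = word_tree w then x (tree_word T) else 0)"
      unfolding sum_fun_apply using True by (intro sum.cong) (auto simp: PP_apply)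
    also have "\<dots> = x (tree_word (word_tree w))" using True finite_trees by simp
    also have "\<dots> = x w" using assms(2) True pos_word_perm_inv[OF is_perm_canon]
      by (metis word_tree_tree_word)
    finally show ?thesis by simp
  next
    case False
    hence "x w = 0" using assms by (meson not_le)
    moreover have "(\<Sum>T | size T \<le> N. fscale (x (tree_word T)) (PP T)) w = 0"
      unfolding sum_fun_apply using False by (intro sum.neutral) (auto simp: PP_apply)
    ultimately show ?thesis by simp
  qed
qed

text \<open>Turns membership in the span into conditions on single words, which can be checked for a
  product without expanding it in the basis.\<close>

lemma PBT_altdef:
  "x \<in> PBT \<longleftrightarrow> (\<forall>w. \<not> pos_word w \<longrightarrow> x w = 0) \<and>
     (\<forall>w w'. pos_word w \<longrightarrow> pos_word w' \<longrightarrow> word_tree w = word_tree w' \<longrightarrow> x w = x w') \<and>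
     (\<exists>N. \<forall>w. length w > N \<longrightarrow> x w = 0)" (is "_ \<longleftrightarrow> ?R x")
proof
  assume "x \<in> PBT"
  thus "?R x" unfolding PBT_def
  proof (induction rule: fun_vs.span_induct_alt)
    case base
    show ?case by simp
  next
    case (step c b y)
    then obtain T where T: "b = PP T" by auto
    from step.IH obtain N where N: "\<forall>w. length w > N \<longrightarrow> y w = 0" by auto
    have "\<forall>w. length w > max N (size T) \<longrightarrow> (fscale c b + y) w = 0"
      using N by (auto simp: T PP_apply)
    moreover have "\<forall>w. \<not> pos_word w \<longrightarrow> (fscale c b + y) w = 0"
      using step.IH by (simp add: T PP_apply)
    moreover have "\<forall>w w'. pos_word w \<longrightarrow> pos_word w' \<longrightarrow> word_tree w = word_tree w' \<longrightarrow>
        (fscale c b + y) w = (fscale c b + y) w'"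
    proof (intro allI impI)
      fix w w' assume w: "pos_word w" "pos_word w'" "word_tree w = word_tree w'"
      hence "y w = y w'" using step.IH by blast
      moreover have "b w = b w'" using w unfolding T PP_apply by presburger
      ultimately show "(fscale c b + y) w = (fscale c b + y) w'" by simp
    qed
    ultimately show ?case by blast
  qed
next
  assume R: "?R x"
  then obtain N where N: "\<And>w. length w > N \<Longrightarrow> x w = 0" by auto
  have "x = (\<Sum>T | size T \<le> N. fscale (x (tree_word T)) (PP T))"
    using R N by (intro word_tree_expand) blast+
  also have "\<dots> \<in> PBT" unfolding PBT_def
    by (intro fun_vs.span_sum fun_vs.span_scale fun_vs.span_base) auto
  finally show "x \<in> PBT" .
qed

lemma PBT_eq:
  assumes "x \<in> PBT" "word_tree w = word_tree w'" "pos_word w" "pos_word w'"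
  shows "x w = x w'"
  using assms unfolding PBT_altdef by blast

lemma PBT_bound:
  assumes "x \<in> PBT" obtains N where "\<And>w. length w > N \<Longrightarrow> x w = 0"
  using assms unfolding PBT_altdef by blast

lemma PP_in_PBT [simp]: "PP T \<in> PBT"
  by (simp add: PBT_def fun_vs.span_base)

lemma PBT_expand:
  assumes "x \<in> PBT" "\<And>w. length w > N \<Longrightarrow> x w = 0"
  shows "x = (\<Sum>T | size T \<le> N. fscale (x (tree_word T)) (PP T))"
  using assms unfolding PBT_altdef by (intro word_tree_expand) blast+

text \<open>The right-hand side is the coefficient of \<open>PP\<close> at the tree of the inverse
  of \<open>\<sigma>\<close>. Hence each term of \<open>QQ'\<close> evaluates \<open>x\<close> at
  the permutation itself.\<close>

lemma PBT_perm_inv: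
  assumes "x \<in> PBT" "is_perm \<sigma>"
  shows "x \<sigma> = x (tree_word (shape (bst_of (perm_inv \<sigma>))))"
  using assms by (intro PBT_eq) (auto simp: word_tree_perm pos_word_perm)

lemma sum_splits:
  "(\<Sum>(u, v)\<in>{(u, v). u @ v = \<sigma>}. f u v) = (\<Sum>k\<le>length \<sigma>. f (take k \<sigma>) (drop k \<sigma>))"
proof -
  have "{(u, v). u @ v = \<sigma>} = (\<lambda>k. (take k \<sigma>, drop k \<sigma>)) ` {..length \<sigma>}"
  proof (intro equalityI subsetI)
    fix p assume "p \<in> {(u, v). u @ v = \<sigma>}"
    then obtain u v where "p = (u, v)" "u @ v = \<sigma>" by auto
    thus "p \<in> (\<lambda>k. (take k \<sigma>, drop k \<sigma>)) ` {..length \<sigma>}"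
      by (intro image_eqI[of _ _ "length u"]) auto
  qed auto
  moreover have "inj_on (\<lambda>k. (take k \<sigma>, drop k \<sigma>)) {..length \<sigma>}"
    by (rule inj_onI) (metis atMost_iff length_take min.absorb2 prod.inject)
  ultimately show ?thesis by (simp add: sum.reindex)
qed

lemma series_mult_apply: "(f \<odot> g) w = (\<Sum>k\<le>length w. f (take k w) * g (drop k w))"
  by (simp add: series_mult_def sum_splits)

lemma series_mult_in_PBT:
  assumes "x \<in> PBT" "y \<in> PBT" shows "x \<odot> y \<in> PBT"
  unfolding PBT_altdef
proof (intro conjI allI impI)
  fix w assume "\<not> pos_word w"
  hence "\<not> pos_word (take k w) \<or> \<not> pos_word (drop k w)" for k
    by (metis Un_iff append_take_drop_id set_append)
  hence "x (take k w) * y (drop k w) = 0" for k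
    using assms unfolding PBT_altdef by (metis mult_eq_0_iff)
  thus "(x \<odot> y) w = 0" by (simp only: series_mult_apply sum.neutral_const)
next
  fix w w' assume w: "pos_word w" "pos_word w'" "word_tree w = word_tree w'"
  have "x (take k w) = x (take k w')" "y (drop k w) = y (drop k w')" for k
    using w by (intro PBT_eq[OF assms(1)] PBT_eq[OF assms(2)] word_tree_take_cong word_tree_drop_cong;
      meson in_set_takeD in_set_dropD)+
  thus "(x \<odot> y) w = (x \<odot> y) w'" using word_tree_eqD(2)[OF w(3)] by (simp add: series_mult_apply)
next
  obtain M where M: "\<And>w. length w > M \<Longrightarrow> x w = 0" by (rule PBT_bound[OF assms(1)]) blast
  obtain N where N: "\<And>w. length w > N \<Longrightarrow> y w = 0" by (rule PBT_bound[OF assms(2)]) blast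
  have "(x \<odot> y) w = 0" if "length w > M + N" for w
    unfolding series_mult_apply
  proof (intro sum.neutral ballI)
    fix k assume "k \<in> {..length w}"
    \<comment> \<open>A word longer than both bounds together leaves, at every cut, one factor
      beyond its own bound.\<close>
    hence "length (take k w) > M \<or> length (drop k w) > N" using that by auto
    thus "x (take k w) * y (drop k w) = 0" using M N by (metis mult_eq_0_iff)
  qed
  thus "\<exists>N. \<forall>w. length w > N \<longrightarrow> (x \<odot> y) w = 0" by blast
qed

subsection \<open>Relabelling and the coproduct\<close>

text \<open>Transports a permutation to the alphabet \<open>A\<close> along the increasing
  bijection; it undoes \<open>std\<close> on words with distinct letters and letter set
  \<open>A\<close>.\<close>

definition relabel :: "nat set \<Rightarrow> nat list \<Rightarrow> nat list" where
  "relabel A \<alpha> = map (\<lambda>i. sorted_list_of_set A ! (i - 1)) \<alpha>"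

lemma length_relabel [simp]: "length (relabel A \<alpha>) = length \<alpha>"
  by (simp add: relabel_def)

lemma std_map:
  assumes "strict_mono_on (set w) f" shows "std (map f w) = std w"
proof -
  have "f (w ! j) < f (w ! i) \<longleftrightarrow> w ! j < w ! i" "f (w ! j) = f (w ! i) \<longleftrightarrow> w ! j = w ! i"
    if "i < length w" "j < length w" for i j
    using that assms strict_mono_on_less[OF assms] strict_mono_on_eqD[OF assms] by auto
  thus ?thesis unfolding std_def
    by (auto intro!: arg_cong[of _ _ card])
qed

lemma strict_mono_on_sorted_list_of_set:
  assumes "finite A"
  shows "strict_mono_on {1..card A} (\<lambda>i. sorted_list_of_set A ! (i - 1))"
proof (rule strict_mono_onI)
  fix r s assume "r \<in> {1..card A}" "s \<in> {1..card A}" "r < s"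
  hence "r - 1 < s - 1" "s - 1 < length (sorted_list_of_set A)" by auto
  thus "sorted_list_of_set A ! (r - 1) < sorted_list_of_set A ! (s - 1)"
    by (intro sorted_wrt_nth_less[OF strict_sorted_list_of_set])
qed

context
  fixes A :: "nat set" and \<alpha> assumes A: "finite A" and \<alpha>: "is_perm \<alpha>" and card: "card A = length \<alpha>"
begin

lemma strict_mono_on_relabel:
  "strict_mono_on (set \<alpha>) (\<lambda>i. sorted_list_of_set A ! (i - 1))"
  using strict_mono_on_sorted_list_of_set[OF A] card \<alpha> by (simp add: is_perm_def)

lemma std_relabel: "std (relabel A \<alpha>) = \<alpha>"
  unfolding relabel_def using std_map[OF strict_mono_on_relabel] std_perm[OF \<alpha>] by simp

lemma bst_of_relabel:
  "bst_of (relabel A \<alpha>) = map_tree (\<lambda>i. sorted_list_of_set A ! (i - 1)) (bst_of \<alpha>)"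
  unfolding relabel_def by (rule bst_of_map[OF strict_mono_on_relabel])

lemma distinct_relabel: "distinct (relabel A \<alpha>)"
  unfolding relabel_def using strict_mono_on_imp_inj_on[OF strict_mono_on_relabel] \<alpha>
  by (simp add: distinct_map is_perm_def)

lemma set_relabel: "set (relabel A \<alpha>) = A"
proof (rule card_subset_eq)
  show "set (relabel A \<alpha>) \<subseteq> A"
  proof
    fix x assume "x \<in> set (relabel A \<alpha>)"
    then obtain i where i: "i \<in> set \<alpha>" "x = sorted_list_of_set A ! (i - 1)" by (auto simp: relabel_def)
    have "i - 1 < length (sorted_list_of_set A)" using i \<alpha> card by (auto simp: is_perm_def)
    thus "x \<in> A" using i nth_mem[of "i - 1" "sorted_list_of_set A"] A by simp
  qed
  show "card (set (relabel A \<alpha>)) = card A"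
    using distinct_card[OF distinct_relabel] card by simp
qed (rule A)

end

lemma std_nth_distinct:
  assumes "distinct w" "i < length w"
  shows "std w ! i = card {y \<in> set w. y \<le> w ! i}"
proof -
  have "{j. j < length w \<and> (w ! j < w ! i \<or> w ! j = w ! i \<and> j \<le> i)} = {j. j < length w \<and> w ! j \<le> w ! i}"
    using assms by (auto simp: nth_eq_iff_index_eq less_le)
  moreover have "{y \<in> set w. y \<le> w ! i} = nth w ` {j. j < length w \<and> w ! j \<le> w ! i}"
    by (auto simp: in_set_conv_nth)
  moreover have "inj_on (nth w) {j. j < length w \<and> w ! j \<le> w ! i}"
    using assms by (auto simp: inj_on_def nth_eq_iff_index_eq)
  ultimately show ?thesis using assms by (simp add: std_def card_image)
qed

text \<open>By \<open>std_nth_distinct\<close> the standardization records the rank of each letter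
  within the letter set, and distinct letters of a common set have distinct ranks.\<close>

lemma std_set_unique:
  assumes "distinct u" "distinct v" "set u = set v" "std u = std v"
  shows "u = v"
proof (rule nth_equalityI)
  show len: "length u = length v" using assms(4) by (metis length_std)
  have less: False if "distinct u" "distinct v" "set u = set v" "std u = std v" "length u = length v"
    "i < length u" "u ! i < v ! i" for i and u v :: "nat list"
  proof -
    have "v ! i \<in> set v" using that by auto
    hence "{y \<in> set u. y \<le> u ! i} \<subset> {y \<in> set v. y \<le> v ! i}" using that by force
    hence "card {y \<in> set u. y \<le> u ! i} < card {y \<in> set v. y \<le> v ! i}" by (intro psubset_card_mono) auto
    thus False using that std_nth_distinct[of u i] std_nth_distinct[of v i] by simp
  qed
  fix i assume "i < length u"
  thus "u ! i = v ! i" using less[of u v i] less[of v u i] assms len by (metis nat_neq_iff)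
qed

lemma relabel_std:
  assumes "distinct u" shows "relabel (set u) (std u) = u"
proof (rule std_set_unique)
  have c: "card (set u) = length (std u)" using assms by (simp add: distinct_card)
  show "distinct (relabel (set u) (std u))" "set (relabel (set u) (std u)) = set u"
    "std (relabel (set u) (std u)) = std u"
    using c by (simp_all add: distinct_relabel set_relabel std_relabel)
qed (rule assms)

text \<open>The coefficient of the tensor product of \<open>FF \<alpha>\<close> and
  \<open>FF \<beta>\<close> in the coproduct of \<open>PP T\<close>.\<close>

definition deconc_coeff :: "unit tree \<Rightarrow> nat list \<Rightarrow> nat list \<Rightarrow> 'k::field" where
  "deconc_coeff T \<alpha> \<beta> = (\<Sum>\<sigma>\<in>tree_class T. \<Sum>k\<le>length \<sigma>.
     if std (take k \<sigma>) = \<alpha> \<and> std (drop k \<sigma>) = \<beta> then 1 else 0)"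

text \<open>A permutation whose two factors standardize to \<open>\<alpha>\<close> and \<open>\<beta>\<close> is determined by the set
  of letters of its first factor, and its tree then depends only on the trees of \<open>\<alpha>\<close> and \<open>\<beta>\<close>.\<close>

lemma deconc_card:
  assumes \<alpha>: "is_perm \<alpha>" and \<beta>: "is_perm \<beta>" and T: "length \<alpha> + length \<beta> = size T"
  shows "deconc_coeff T \<alpha> \<beta> = (of_nat :: nat \<Rightarrow> 'k::field) (card {A. A \<subseteq> {1..size T} \<and> card A = length \<alpha> \<and>
    shape (plug (map_tree (\<lambda>i. sorted_list_of_set ({1..size T} - A) ! (i - 1)) (bst_of \<beta>))
                (map_tree (\<lambda>i. sorted_list_of_set A ! (i - 1)) (bst_of \<alpha>))) = T})"
    (is "_ = _ (card ?R)")
proof -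
  define p where "p = length \<alpha>"
  let ?N = "{1..size T}"
  let ?L = "{\<sigma> \<in> tree_class T. std (take p \<sigma>) = \<alpha> \<and> std (drop p \<sigma>) = \<beta>}"
  have split: "distinct (take p \<sigma> @ drop p \<sigma>) \<and> set (take p \<sigma> @ drop p \<sigma>) = ?N"
    if "\<sigma> \<in> tree_class T" for \<sigma>
    using that tree_class_length[OF that] unfolding append_take_drop_id is_perm_def by simp
  have "deconc_coeff T \<alpha> \<beta> =
    (\<Sum>\<sigma>\<in>tree_class T. if std (take p \<sigma>) = \<alpha> \<and> std (drop p \<sigma>) = \<beta> then 1 else (0::'k))"
    unfolding deconc_coeff_def
  proof (rule sum.cong)
    fix \<sigma> assume "\<sigma> \<in> tree_class T"
    hence len: "p \<le> length \<sigma>" using T tree_class_length[of \<sigma> T] by (simp add: p_def)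
    \<comment> \<open>Standardization preserves length, so only the cut after \<open>p\<close>
      letters can contribute.\<close>
    have "(\<Sum>k\<le>length \<sigma>. if std (take k \<sigma>) = \<alpha> \<and> std (drop k \<sigma>) = \<beta> then 1 else 0) =
          (\<Sum>k\<le>length \<sigma>. if k = p then (if std (take p \<sigma>) = \<alpha> \<and> std (drop p \<sigma>) = \<beta> then 1 else 0) else (0::'k))"
    proof (rule sum.cong)
      fix k assume "k \<in> {..length \<sigma>}"
      hence "length (std (take k \<sigma>)) = k" by simp
      thus "(if std (take k \<sigma>) = \<alpha> \<and> std (drop k \<sigma>) = \<beta> then 1 else 0) =
        (if k = p then (if std (take p \<sigma>) = \<alpha> \<and> std (drop p \<sigma>) = \<beta> then 1 else 0) else (0::'k))"
        by (auto simp: p_def)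
    qed simp
    thus "(\<Sum>k\<le>length \<sigma>. if std (take k \<sigma>) = \<alpha> \<and> std (drop k \<sigma>) = \<beta> then 1 else 0) =
      (if std (take p \<sigma>) = \<alpha> \<and> std (drop p \<sigma>) = \<beta> then 1 else (0::'k))" using len by simp
  qed simp
  also have "\<dots> = of_nat (card ?L)"
    by (simp add: sum.If_cases Int_def conj_assoc)
  \<comment> \<open>The bijection sends a permutation to the set of letters of its first factor.
    Conversely, a set \<open>A\<close> gives back the two factors by relabelling
    \<open>\<alpha>\<close> with \<open>A\<close> and \<open>\<beta>\<close> with the
    complement.\<close>
  also have "card ?L = card ?R"
  proof (rule bij_betw_same_card, rule bij_betw_byWitness)
    show "\<forall>\<sigma>\<in>?L. relabel (set (take p \<sigma>)) \<alpha> @ relabel (?N - set (take p \<sigma>)) \<beta> = \<sigma>"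
    proof
      fix \<sigma> assume \<sigma>: "\<sigma> \<in> ?L"
      have "distinct (take p \<sigma> @ drop p \<sigma>)" "set (take p \<sigma> @ drop p \<sigma>) = ?N"
        using split[of \<sigma>] \<sigma> by blast+
      hence "?N - set (take p \<sigma>) = set (drop p \<sigma>)" "distinct (take p \<sigma>)" "distinct (drop p \<sigma>)"
        by (auto simp del: append_take_drop_id)
      thus "relabel (set (take p \<sigma>)) \<alpha> @ relabel (?N - set (take p \<sigma>)) \<beta> = \<sigma>"
        using \<sigma> relabel_std[of "take p \<sigma>"] relabel_std[of "drop p \<sigma>"] by auto
    qed
    have R: "set (take p (relabel A \<alpha> @ relabel (?N - A) \<beta>)) = A \<and>
      relabel A \<alpha> @ relabel (?N - A) \<beta> \<in> ?L" if "A \<in> ?R" for A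
    proof -
      have A: "A \<subseteq> ?N" "card A = length \<alpha>" using that by auto
      have fin: "finite A" "finite (?N - A)" using A(1) finite_subset by auto
      have cB: "card (?N - A) = length \<beta>" using A T fin by (simp add: card_Diff_subset)
      have "is_perm (relabel A \<alpha> @ relabel (?N - A) \<beta>)"
        using A fin cB \<alpha> \<beta> T by (auto simp: is_perm_def distinct_relabel set_relabel)
      thus ?thesis using that A fin cB \<alpha> \<beta>
        by (simp add: p_def set_relabel std_relabel bst_of_append bst_of_relabel)
    qed
    show "\<forall>A\<in>?R. set (take p (relabel A \<alpha> @ relabel (?N - A) \<beta>)) = A" using R by blast
    show "(\<lambda>A. relabel A \<alpha> @ relabel (?N - A) \<beta>) ` ?R \<subseteq> ?L" using R by blast
    show "(\<lambda>\<sigma>. set (take p \<sigma>)) ` ?L \<subseteq> ?R"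
    proof (rule image_subsetI)
      fix \<sigma> assume \<sigma>: "\<sigma> \<in> ?L"
      have d: "distinct (take p \<sigma> @ drop p \<sigma>)" "set (take p \<sigma> @ drop p \<sigma>) = ?N"
        using split[of \<sigma>] \<sigma> by blast+
      hence B: "?N - set (take p \<sigma>) = set (drop p \<sigma>)" and d': "distinct (take p \<sigma>)" "distinct (drop p \<sigma>)"
        by (auto simp del: append_take_drop_id)
      have "length \<sigma> = size T" using \<sigma> by auto
      hence c: "card (set (take p \<sigma>)) = length \<alpha>" "card (set (drop p \<sigma>)) = length \<beta>"
        using d' T by (simp_all add: distinct_card p_def)
      have "relabel (set (take p \<sigma>)) \<alpha> = take p \<sigma>" "relabel (set (drop p \<sigma>)) \<beta> = drop p \<sigma>"
        using \<sigma> relabel_std[OF d'(1)] relabel_std[OF d'(2)] by auto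
      hence "bst_of \<sigma> = plug (bst_of (relabel (set (drop p \<sigma>)) \<beta>)) (bst_of (relabel (set (take p \<sigma>)) \<alpha>))"
        by (simp flip: bst_of_append)
      also have "\<dots> = plug (map_tree (\<lambda>i. sorted_list_of_set (set (drop p \<sigma>)) ! (i - 1)) (bst_of \<beta>))
                (map_tree (\<lambda>i. sorted_list_of_set (set (take p \<sigma>)) ! (i - 1)) (bst_of \<alpha>))"
        using c \<alpha> \<beta> by (simp only: bst_of_relabel finite_set)
      finally have "shape \<dots> = T" using \<sigma> by simp
      moreover have "set (take p \<sigma>) \<subseteq> ?N" using d(2) unfolding set_append by blast
      ultimately show "set (take p \<sigma>) \<in> ?R" using c(1) unfolding mem_Collect_eq B by blast
    qed
  qed
  finally show ?thesis .
qed

lemma deconc_eq_0: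
  assumes "length \<alpha> + length \<beta> \<noteq> size T"
  shows "deconc_coeff T \<alpha> \<beta> = 0"
  unfolding deconc_coeff_def
proof (intro sum.neutral ballI)
  fix \<sigma> k assume *: "\<sigma> \<in> tree_class T" "k \<in> {..length \<sigma>}"
  have "length (std (take k \<sigma>)) + length (std (drop k \<sigma>)) = size T"
    using * tree_class_length[of \<sigma> T] by auto
  thus "(if std (take k \<sigma>) = \<alpha> \<and> std (drop k \<sigma>) = \<beta> then 1 else 0) = 0" using assms by auto
qed

text \<open>The count in \<open>deconc_card\<close> sees \<open>\<alpha>\<close> and
  \<open>\<beta>\<close> only through their search trees and the length of \<open>\<alpha>\<close>.
  This is what makes the coproduct of \<open>PP T\<close> an expansion in the basis
  \<open>PP2\<close>.\<close>

lemma deconc_cong: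
  assumes "is_perm \<alpha>" "is_perm \<alpha>'" "is_perm \<beta>" "is_perm \<beta>'"
    and "shape (bst_of \<alpha>) = shape (bst_of \<alpha>')" "shape (bst_of \<beta>) = shape (bst_of \<beta>')"
  shows "deconc_coeff T \<alpha> \<beta> = deconc_coeff T \<alpha>' \<beta>'"
proof -
  have len: "length \<alpha> = length \<alpha>'" "length \<beta> = length \<beta>'"
    using assms(5,6) by (metis size_bst_of size_shape)+
  have eq: "bst_of \<alpha> = bst_of \<alpha>'" "bst_of \<beta> = bst_of \<beta>'" using assms by (auto intro: bst_of_perm_eq)
  show ?thesis
  proof (cases "length \<alpha> + length \<beta> = size T")
    case True
    thus ?thesis using assms len by (simp only: deconc_card eq)
  next
    case False
    thus ?thesis using len by (simp add: deconc_eq_0)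
  qed
qed

lemma PBT_subset_span_FF: "PBT \<subseteq> fun_vs.span (FF ` {\<sigma>. is_perm \<sigma>})"
  unfolding PBT_def
proof (rule fun_vs.span_minimal)
  show "range PP \<subseteq> fun_vs.span (FF ` {\<sigma>. is_perm \<sigma>})"
    by (auto simp: PP_def intro: fun_vs.span_sum fun_vs.span_base)
qed (rule fun_vs.subspace_span)

lemma coprod_PP_apply:
  "coprod (PP T) (v, w) = (if pos_word v \<and> pos_word w then deconc_coeff T (inv_std v) (inv_std w) else (0 :: 'k::field))"
proof -
  let ?h = "\<lambda>\<sigma>. \<Sum>k\<le>length \<sigma>. tensor (FF (std (take k \<sigma>))) (FF (std (drop k \<sigma>))) :: _ \<Rightarrow> 'k"
  have PP: "PP T (perm_inv \<sigma>) = (if \<sigma> \<in> tree_class T then 1 else (0::'k))" if "is_perm \<sigma>" for \<sigma>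
    using that pos_word_perm_inv[OF that] by (simp add: PP_apply word_tree_perm_inv)
  have "coprod (PP T :: 'k series) = (\<Sum>\<sigma>\<in>tree_class T. fscale (PP T (perm_inv \<sigma>)) (?h \<sigma>))"
    unfolding coprod_def sum_splits
    using PBT_subset_span_FF PP_in_PBT[of T] PP by (intro FFd.lin_ext_eq) (auto simp: fun_eq_iff)
  also have "\<dots> = (\<Sum>\<sigma>\<in>tree_class T. ?h \<sigma>)"
    by (intro sum.cong) (auto simp: PP fun_eq_iff)
  finally have "coprod (PP T :: 'k series) (v, w) =
    (\<Sum>\<sigma>\<in>tree_class T. \<Sum>k\<le>length \<sigma>. FF (std (take k \<sigma>)) v * FF (std (drop k \<sigma>)) w)"
    by (simp add: sum_fun_apply tensor_def)
  also have "\<dots> = (if pos_word v \<and> pos_word w then deconc_coeff T (inv_std v) (inv_std w) else 0)"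
    by (auto simp: deconc_coeff_def FF_apply intro!: sum.cong sum.neutral)
  finally show ?thesis .
qed

lemma coprod_PP_expand:
  "coprod (PP T) = (\<Sum>(R, S)\<in>{R. size R \<le> size T} \<times> {S. size S \<le> size T}.
     fscale (deconc_coeff T (canon R) (canon S)) (PP2 (R, S) :: _ \<Rightarrow> 'k::field))" (is "_ = ?rhs")
proof
  fix p :: "nat list \<times> nat list"
  obtain v w where p: "p = (v, w)" by (cases p)
  have "?rhs (v, w) = (\<Sum>R | size R \<le> size T. \<Sum>S | size S \<le> size T.
      if pos_word v \<and> pos_word w \<and> R = word_tree v \<and> S = word_tree w
      then deconc_coeff T (canon R) (canon S) else 0)"
    unfolding sum_fun_apply sum.cartesian_product
    by (intro sum.cong) (auto simp: PP2_def tensor_def PP_apply)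
  also have "\<dots> = coprod (PP T) (v, w)"
  proof (cases "pos_word v \<and> pos_word w")
    case True
    have "(\<Sum>R | size R \<le> size T. \<Sum>S | size S \<le> size T.
        if pos_word v \<and> pos_word w \<and> R = word_tree v \<and> S = word_tree w
        then deconc_coeff T (canon R) (canon S) else 0) =
      (\<Sum>R | size R \<le> size T. if R = word_tree v then (\<Sum>S | size S \<le> size T.
        if S = word_tree w then deconc_coeff T (canon R) (canon S) else 0) else (0::'k))"
      using True by (intro sum.cong) auto
    also have "\<dots> = (if length v \<le> size T \<and> length w \<le> size T
        then deconc_coeff T (canon (word_tree v)) (canon (word_tree w)) else 0)"
      by (simp add: finite_trees)
    also have "\<dots> = deconc_coeff T (canon (word_tree v)) (canon (word_tree w))"
      by (auto simp: deconc_eq_0)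
    also have "\<dots> = deconc_coeff T (inv_std v) (inv_std w)"
      by (rule deconc_cong) (simp_all add: word_tree_def)
    finally show ?thesis using True by (simp add: coprod_PP_apply)
  next
    case False
    hence "(\<Sum>R | size R \<le> size T. \<Sum>S | size S \<le> size T.
        if pos_word v \<and> pos_word w \<and> R = word_tree v \<and> S = word_tree w
        then deconc_coeff T (canon R) (canon S) else 0) = (0::'k)"
      by (intro sum.neutral) auto
    thus ?thesis using False by (auto simp: coprod_PP_apply)
  qed
  finally show "coprod (PP T) p = ?rhs p" using p by simp
qed

lemma coprod_PP_in_span: "coprod (PP T) \<in> fun_vs.span (range PP2)"
  unfolding coprod_PP_expand
  by (intro fun_vs.span_sum) (auto intro: fun_vs.span_scale fun_vs.span_base)

lemma lin_ext_coprod_PP: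
  assumes "\<And>v. s 0 v = 0"
  shows "lin_ext s UNIV PP2 h (coprod (PP T :: 'k::field series)) =
    (\<Sum>R | size R \<le> size T. \<Sum>S | size S \<le> size T. s (deconc_coeff T (canon R) (canon S)) (h (R, S)))"
proof -
  \<comment> \<open>The inverse standardization of the test word of a tree is its canonical
    permutation, so the coordinates are the coefficients at canonical permutations.\<close>
  have at: "coprod (PP T) (case p of (R, S) \<Rightarrow> (tree_word R, tree_word S)) =
    (deconc_coeff T (canon (fst p)) (canon (snd p)) :: 'k)" for p
    using pos_word_perm_inv[OF is_perm_canon]
    by (cases p) (simp add: coprod_PP_apply inv_std_perm)
  have "lin_ext s UNIV PP2 h (coprod (PP T :: 'k series)) =
    (\<Sum>p\<in>{R. size R \<le> size T} \<times> {S. size S \<le> size T}.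
      s (coprod (PP T) (case p of (R, S) \<Rightarrow> (tree_word R, tree_word S))) (h p))"
  proof (rule PP2d.lin_ext_eq)
    fix p :: "unit tree \<times> unit tree"
    assume "p \<in> UNIV - {R. size R \<le> size T} \<times> {S. size S \<le> size T}"
    thus "coprod (PP T) (case p of (R, S) \<Rightarrow> (tree_word R, tree_word S)) = (0 :: 'k)"
      unfolding at by (cases p) (auto intro!: deconc_eq_0)
  qed (auto simp: assms coprod_PP_in_span finite_trees)
  also have "\<dots> = (\<Sum>R | size R \<le> size T. \<Sum>S | size S \<le> size T.
      s (deconc_coeff T (canon R) (canon S)) (h (R, S)))"
    unfolding at sum.cartesian_product by (intro sum.cong) auto
  finally show ?thesis .
qed

subsection \<open>The map \<open>phi\<close> as a symmetric bilinear form\<close>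

lemma PBT_closed: "x \<in> PBT \<Longrightarrow> y \<in> PBT \<Longrightarrow> x + y \<in> PBT" "x \<in> PBT \<Longrightarrow> fscale c x \<in> PBT"
  "0 \<in> PBT"
  by (auto simp: PBT_def fun_vs.span_add fun_vs.span_scale fun_vs.span_zero)

lemma linear_on_PBT_expand:
  assumes "linear_on s PBT f" "\<And>v. s 0 v = 0" "x \<in> PBT" "\<And>w. length w > N \<Longrightarrow> x w = 0"
  shows "f x = (\<Sum>T | size T \<le> N. s (x (tree_word T)) (f (PP T)))"
proof -
  \<comment> \<open>Scaling by 0 yields \<open>f 0 = 0\<close>, which starts the induction over
    finite sums.\<close>
  have "fscale 0 (0 :: 'a series) = 0" by (simp add: fun_eq_iff)
  hence "f 0 = s 0 (f 0)" using assms(1) PBT_closed(3) unfolding linear_on_def by metis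
  hence f0: "f 0 = 0" by (simp add: assms(2))
  have *: "(\<Sum>T\<in>B. fscale (c T) (PP T)) \<in> PBT \<and>
    f (\<Sum>T\<in>B. fscale (c T) (PP T)) = (\<Sum>T\<in>B. s (c T) (f (PP T)))" if "finite B" for B c
    using that
  proof induction
    case empty
    show ?case unfolding sum.empty using PBT_closed(3) f0 by blast
  next
    case (insert T B)
    have A: "fscale (c T) (PP T) \<in> PBT" using PBT_closed(2) PP_in_PBT by blast
    have "f (fscale (c T) (PP T)) = s (c T) (f (PP T))"
      using assms(1) PP_in_PBT unfolding linear_on_def by blast
    moreover have "f (fscale (c T) (PP T) + (\<Sum>T\<in>B. fscale (c T) (PP T))) =
        f (fscale (c T) (PP T)) + f (\<Sum>T\<in>B. fscale (c T) (PP T))"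
      using assms(1) insert.IH A unfolding linear_on_def by blast
    ultimately have "f (fscale (c T) (PP T) + (\<Sum>T\<in>B. fscale (c T) (PP T))) =
        s (c T) (f (PP T)) + (\<Sum>T\<in>B. s (c T) (f (PP T)))"
      using insert.IH by (simp only:)
    thus ?case unfolding sum.insert[OF insert.hyps]
      by (intro conjI PBT_closed(1)[OF A insert.IH[THEN conjunct1]])
  qed
  have "x = (\<Sum>T | size T \<le> N. fscale (x (tree_word T)) (PP T))"
    using assms(3,4) by (rule PBT_expand)
  hence "f x = f (\<Sum>T | size T \<le> N. fscale (x (tree_word T)) (PP T))" by (rule arg_cong)
  also have "\<dots> = (\<Sum>T | size T \<le> N. s (x (tree_word T)) (f (PP T)))"
    by (rule *[OF finite_trees, THEN conjunct2])
  finally show ?thesis .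
qed

lemma QQ_apply: "QQ T x = (if x \<in> PBT then x (tree_word T) else 0)"
  using PPd.coord_eq[of x T] PPd.coord_outside[of x T] by (simp add: QQ_def PBT_def)

lemma QQ'_apply: "QQ' T x = (if x \<in> PBT then \<Sum>\<sigma>\<in>tree_class T. x \<sigma> else 0)"
  unfolding QQ'_def sum_fun_apply
  by (auto simp: QQ_apply intro!: sum.cong dest: PBT_perm_inv)

lemma linear_on_phi: "linear_on fscale PBT phi"
  unfolding linear_on_def PBT_def phi_def
  by (intro conjI ballI allI PPd.lin_ext_add PPd.lin_ext_scale)
    (auto simp: fun_eq_iff algebra_simps)

lemma phi_PP: "phi (PP T) = QQ' T"
  unfolding phi_def by (rule PPd.lin_ext_base) (auto simp: fun_eq_iff)

text \<open>The coefficient of \<open>x\<close> at \<open>T\<close> is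
  \<open>x (perm_inv \<sigma>)\<close> for each \<open>\<sigma>\<close> in the class of
  \<open>T\<close>; the sums over trees and over their classes then merge into a single sum over
  permutations.\<close>

lemma phi_apply:
  assumes "x \<in> PBT" "\<And>w. length w > N \<Longrightarrow> x w = 0"
  shows "phi x z = (if z \<in> PBT then \<Sum>\<sigma> | is_perm \<sigma> \<and> length \<sigma> \<le> N. x (perm_inv \<sigma>) * z \<sigma> else 0)"
proof -
  let ?P = "{\<sigma>. is_perm \<sigma> \<and> length \<sigma> \<le> N}"
  have "phi x = (\<Sum>T | size T \<le> N. fscale (x (tree_word T)) (QQ' T))"
    unfolding phi_def using assms
    by (intro PPd.lin_ext_eq) (auto simp: PBT_def finite_trees fun_eq_iff)
  hence *: "phi x z = (\<Sum>T | size T \<le> N. x (tree_word T) * QQ' T z)" by (simp add: sum_fun_apply)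
  show ?thesis
  proof (cases "z \<in> PBT")
    case True
    have "(\<Sum>T | size T \<le> N. x (tree_word T) * QQ' T z) =
      (\<Sum>T | size T \<le> N. \<Sum>\<sigma>\<in>{\<sigma> \<in> ?P. shape (bst_of \<sigma>) = T}. x (perm_inv \<sigma>) * z \<sigma>)"
    proof (rule sum.cong)
      fix T :: "unit tree" assume "T \<in> {T. size T \<le> N}"
      hence cls: "{\<sigma> \<in> ?P. shape (bst_of \<sigma>) = T} = tree_class T" by auto
      have "x (tree_word T) = x (perm_inv \<sigma>)" if "\<sigma> \<in> tree_class T" for \<sigma>
        using that PBT_perm_inv[OF assms(1), of "perm_inv \<sigma>"] by auto
      thus "x (tree_word T) * QQ' T z =
        (\<Sum>\<sigma>\<in>{\<sigma> \<in> ?P. shape (bst_of \<sigma>) = T}. x (perm_inv \<sigma>) * z \<sigma>)"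
        using True unfolding cls by (simp add: QQ'_apply sum_distrib_left)
    qed simp
    also have "\<dots> = (\<Sum>\<sigma>\<in>?P. x (perm_inv \<sigma>) * z \<sigma>)"
      by (rule sum.group) (auto simp: finite_perms finite_trees)
    finally show ?thesis using * True by simp
  next
    case False
    thus ?thesis using * by (simp add: QQ'_apply)
  qed
qed

lemma phi_sym:
  assumes "x \<in> PBT" "y \<in> PBT"
  shows "phi x y = phi y x"
proof -
  obtain M where M: "\<And>w. length w > M \<Longrightarrow> x w = 0" by (rule PBT_bound[OF assms(1)]) blast
  obtain N where N: "\<And>w. length w > N \<Longrightarrow> y w = 0" by (rule PBT_bound[OF assms(2)]) blast
  let ?K = "max M N"
  have "phi x y = (\<Sum>\<sigma> | is_perm \<sigma> \<and> length \<sigma> \<le> ?K. x (perm_inv \<sigma>) * y \<sigma>)"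
    using assms M by (simp add: phi_apply[of x ?K])
  \<comment> \<open>Inversion permutes the index set and exchanges the two arguments of the
    form.\<close>
  also have "\<dots> = (\<Sum>\<sigma> | is_perm \<sigma> \<and> length \<sigma> \<le> ?K. y (perm_inv \<sigma>) * x \<sigma>)"
    by (rule sum.reindex_bij_witness[of _ perm_inv perm_inv]) auto
  also have "\<dots> = phi y x"
    using assms N by (simp add: phi_apply[of y ?K])
  finally show ?thesis .
qed

lemma QQ'_PP_sym: "QQ' S (PP T) = QQ' T (PP S)"
  using phi_sym[of "PP S" "PP T"] by (simp add: phi_PP)

lemma phi_at_PP: "x \<in> PBT \<Longrightarrow> phi x (PP T) = QQ' T x"
  by (simp add: phi_sym[of x "PP T"] phi_PP)

lemma linear_on_phi_apply:
  assumes "x \<in> PBT" shows "linear_on (*) PBT (phi x)"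
proof -
  obtain N where N: "\<And>w. length w > N \<Longrightarrow> x w = 0" by (rule PBT_bound[OF assms(1)]) blast
  show ?thesis unfolding linear_on_def
    by (simp add: phi_apply[OF assms N] PBT_closed algebra_simps sum.distrib sum_distrib_left)
qed

lemma PBT_forms_eqI:
  assumes "linear_on (*) PBT f" "linear_on (*) PBT g"
    and "\<And>x. x \<notin> PBT \<Longrightarrow> f x = g x" "\<And>T. f (PP T) = g (PP T)"
  shows "f = g"
proof
  fix x
  show "f x = g x"
  proof (cases "x \<in> PBT")
    case True
    obtain N where N: "\<And>w. length w > N \<Longrightarrow> x w = 0" by (rule PBT_bound[OF True]) blast
    have "f x = (\<Sum>T | size T \<le> N. x (tree_word T) * f (PP T))"
      using assms(1) True N by (intro linear_on_PBT_expand) auto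
    moreover have "g x = (\<Sum>T | size T \<le> N. x (tree_word T) * g (PP T))"
      using assms(2) True N by (intro linear_on_PBT_expand) auto
    ultimately show ?thesis by (simp add: assms(4))
  qed (rule assms(3))
qed

subsection \<open>Compatibility with products and coproducts\<close>

lemma sum_over_trees:
  "(\<Sum>T | size T \<le> N. \<Sum>\<sigma>\<in>tree_class T. f T \<sigma>) =
   (\<Sum>\<sigma> | is_perm \<sigma> \<and> length \<sigma> \<le> N. f (shape (bst_of \<sigma>)) \<sigma>)"
proof -
  let ?P = "{\<sigma>. is_perm \<sigma> \<and> length \<sigma> \<le> N}"
  have "(\<Sum>T | size T \<le> N. \<Sum>\<sigma>\<in>tree_class T. f T \<sigma>) =
    (\<Sum>T | size T \<le> N. \<Sum>\<sigma>\<in>{\<sigma> \<in> ?P. shape (bst_of \<sigma>) = T}. f (shape (bst_of \<sigma>)) \<sigma>)"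
    by (intro sum.cong) auto
  also have "\<dots> = (\<Sum>\<sigma>\<in>?P. f (shape (bst_of \<sigma>)) \<sigma>)"
    by (rule sum.group) (auto simp: finite_perms finite_trees)
  finally show ?thesis .
qed

text \<open>Adjointness of coproduct and product. Each cut of each \<open>\<sigma>\<close> selects
  one pair of permutations, its standardized factors, and elements of \<open>PBT\<close> take the
  same value at a factor and at its standardization.\<close>

lemma sum_deconc_coeff:
  assumes "x \<in> PBT" "y \<in> PBT"
  shows "(\<Sum>\<alpha> | is_perm \<alpha> \<and> length \<alpha> \<le> size T. \<Sum>\<beta> | is_perm \<beta> \<and> length \<beta> \<le> size T.
    deconc_coeff T \<alpha> \<beta> * (x \<alpha> * y \<beta>)) = QQ' T (x \<odot> y)"
proof -
  let ?P = "{\<alpha>. is_perm \<alpha> \<and> length \<alpha> \<le> size T}"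
  have "(\<Sum>\<alpha>\<in>?P. \<Sum>\<beta>\<in>?P. deconc_coeff T \<alpha> \<beta> * (x \<alpha> * y \<beta>)) =
    (\<Sum>(\<alpha>, \<beta>)\<in>?P \<times> ?P. deconc_coeff T \<alpha> \<beta> * (x \<alpha> * y \<beta>))"
    by (rule sum.cartesian_product)
  also have "\<dots> = (\<Sum>(\<alpha>, \<beta>)\<in>?P \<times> ?P. \<Sum>\<sigma>\<in>tree_class T. \<Sum>k\<le>length \<sigma>.
      if std (take k \<sigma>) = \<alpha> \<and> std (drop k \<sigma>) = \<beta> then x \<alpha> * y \<beta> else 0)"
    unfolding deconc_coeff_def sum_distrib_right by (intro sum.cong) (auto intro!: sum.cong)
  also have "\<dots> = (\<Sum>\<sigma>\<in>tree_class T. \<Sum>(\<alpha>, \<beta>)\<in>?P \<times> ?P. \<Sum>k\<le>length \<sigma>.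
      if std (take k \<sigma>) = \<alpha> \<and> std (drop k \<sigma>) = \<beta> then x \<alpha> * y \<beta> else 0)"
    unfolding case_prod_unfold by (rule sum.swap)
  also have "\<dots> = (\<Sum>\<sigma>\<in>tree_class T. \<Sum>k\<le>length \<sigma>. x (take k \<sigma>) * y (drop k \<sigma>))"
  proof (rule sum.cong)
    fix \<sigma> assume \<sigma>: "\<sigma> \<in> tree_class T"
    have "(\<Sum>(\<alpha>, \<beta>)\<in>?P \<times> ?P. \<Sum>k\<le>length \<sigma>.
        if std (take k \<sigma>) = \<alpha> \<and> std (drop k \<sigma>) = \<beta> then x \<alpha> * y \<beta> else 0) =
      (\<Sum>k\<le>length \<sigma>. \<Sum>p\<in>?P \<times> ?P.
        if p = (std (take k \<sigma>), std (drop k \<sigma>)) then x (fst p) * y (snd p) else 0)"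
      unfolding case_prod_unfold by (subst sum.swap) (intro sum.cong; force)
    also have "\<dots> = (\<Sum>k\<le>length \<sigma>. x (take k \<sigma>) * y (drop k \<sigma>))"
    proof (rule sum.cong)
      fix k assume "k \<in> {..length \<sigma>}"
      have mem: "(std (take k \<sigma>), std (drop k \<sigma>)) \<in> ?P \<times> ?P"
        using tree_class_length[OF \<sigma>] by simp
      have pos: "pos_word (take k \<sigma>)" "pos_word (drop k \<sigma>)"
        using \<sigma> pos_word_perm[of \<sigma>] by (auto dest: in_set_takeD in_set_dropD)
      have "x (std (take k \<sigma>)) = x (take k \<sigma>)" "y (std (drop k \<sigma>)) = y (drop k \<sigma>)"
        using pos by (auto intro!: PBT_eq[OF assms(1)] PBT_eq[OF assms(2)] pos_word_perm simp: word_tree_std)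
      thus "(\<Sum>p\<in>?P \<times> ?P. if p = (std (take k \<sigma>), std (drop k \<sigma>)) then x (fst p) * y (snd p) else 0) =
        x (take k \<sigma>) * y (drop k \<sigma>)"
        using mem finite_perms[of "size T"] by (simp only: sum.delta finite_SigmaI) simp
    qed simp
    finally show "(\<Sum>(\<alpha>, \<beta>)\<in>?P \<times> ?P. \<Sum>k\<le>length \<sigma>.
        if std (take k \<sigma>) = \<alpha> \<and> std (drop k \<sigma>) = \<beta> then x \<alpha> * y \<beta> else 0) =
      (\<Sum>k\<le>length \<sigma>. x (take k \<sigma>) * y (drop k \<sigma>))" .
  qed simp
  also have "\<dots> = QQ' T (x \<odot> y)"
    using series_mult_in_PBT[OF assms] by (simp add: QQ'_apply series_mult_apply)
  finally show ?thesis .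
qed

text \<open>The same adjointness at the level of trees: the coefficients are constant on classes, so
  the sums over classes contained in \<open>QQ'\<close> can be opened up.\<close>

lemma sum_deconc_QQ':
  assumes "x \<in> PBT" "y \<in> PBT"
  shows "(\<Sum>R | size R \<le> size T. \<Sum>S | size S \<le> size T.
    deconc_coeff T (canon R) (canon S) * (QQ' R x * QQ' S y)) = QQ' T (x \<odot> y)"
proof -
  have "(\<Sum>R | size R \<le> size T. \<Sum>S | size S \<le> size T.
      deconc_coeff T (canon R) (canon S) * (QQ' R x * QQ' S y)) =
    (\<Sum>R | size R \<le> size T. \<Sum>\<alpha>\<in>tree_class R. \<Sum>S | size S \<le> size T. \<Sum>\<beta>\<in>tree_class S.
      deconc_coeff T \<alpha> \<beta> * (x \<alpha> * y \<beta>))"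
  proof (rule sum.cong)
    fix R :: "unit tree"
    have "(\<Sum>S | size S \<le> size T. deconc_coeff T (canon R) (canon S) * (QQ' R x * QQ' S y)) =
      (\<Sum>S | size S \<le> size T. \<Sum>\<alpha>\<in>tree_class R. \<Sum>\<beta>\<in>tree_class S. deconc_coeff T \<alpha> \<beta> * (x \<alpha> * y \<beta>))"
    proof (rule sum.cong)
      fix S :: "unit tree"
      have "deconc_coeff T (canon R) (canon S) * (QQ' R x * QQ' S y) =
        (\<Sum>\<alpha>\<in>tree_class R. \<Sum>\<beta>\<in>tree_class S. deconc_coeff T (canon R) (canon S) * (x \<alpha> * y \<beta>))"
      proof -
        have "QQ' R x * QQ' S y = (\<Sum>\<alpha>\<in>tree_class R. \<Sum>\<beta>\<in>tree_class S. x \<alpha> * y \<beta>)"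
          using assms by (simp add: QQ'_apply sum_product)
        thus ?thesis by (simp only: sum_distrib_left)
      qed
      also have "\<dots> = (\<Sum>\<alpha>\<in>tree_class R. \<Sum>\<beta>\<in>tree_class S. deconc_coeff T \<alpha> \<beta> * (x \<alpha> * y \<beta>))"
        by (intro sum.cong arg_cong2[of _ _ _ _ "(*)"] deconc_cong) auto
      finally show "deconc_coeff T (canon R) (canon S) * (QQ' R x * QQ' S y) = \<dots>" .
    qed simp
    also have "\<dots> = (\<Sum>\<alpha>\<in>tree_class R. \<Sum>S | size S \<le> size T. \<Sum>\<beta>\<in>tree_class S.
        deconc_coeff T \<alpha> \<beta> * (x \<alpha> * y \<beta>))"
      by (rule sum.swap)
    finally show "(\<Sum>S | size S \<le> size T. deconc_coeff T (canon R) (canon S) * (QQ' R x * QQ' S y)) = \<dots>" .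
  qed simp
  also have "\<dots> = (\<Sum>\<alpha> | is_perm \<alpha> \<and> length \<alpha> \<le> size T. \<Sum>\<beta> | is_perm \<beta> \<and> length \<beta> \<le> size T.
    deconc_coeff T \<alpha> \<beta> * (x \<alpha> * y \<beta>))"
    by (simp only: sum_over_trees)
  finally show ?thesis using sum_deconc_coeff[OF assms] by simp
qed

lemma tensor_map_phi_coprod: "tensor_map phi phi (coprod (PP T)) = dual_coprod (QQ' T)"
proof
  fix p :: "'k::field series \<times> 'k series"
  obtain x y where p: "p = (x, y)" by (cases p)
  have "tensor_map phi phi (coprod (PP T)) (x, y) =
    (\<Sum>R | size R \<le> size T. \<Sum>S | size S \<le> size T.
      deconc_coeff T (canon R) (canon S) * (QQ' R x * QQ' S y))"
    unfolding tensor_map_def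
    by (subst lin_ext_coprod_PP) (auto simp: fun_eq_iff sum_fun_apply phi_PP tensor_def)
  also have "\<dots> = dual_coprod (QQ' T) (x, y)"
  proof (cases "x \<in> PBT \<and> y \<in> PBT")
    case True
    thus ?thesis by (simp add: sum_deconc_QQ' dual_coprod_def)
  next
    \<comment> \<open>Outside \<open>PBT\<close> both sides carry the default value 0.\<close>
    case False
    hence "QQ' R x * QQ' S y = 0" for R S by (auto simp: QQ'_apply)
    moreover have "dual_coprod (QQ' T) (x, y) = 0" using False by (auto simp: dual_coprod_def)
    ultimately show ?thesis by (simp only: mult_zero_right sum.neutral_const)
  qed
  finally show "tensor_map phi phi (coprod (PP T)) p = dual_coprod (QQ' T) p" using p by simp
qed

lemma coprod_add:
  assumes "x \<in> PBT" "y \<in> PBT" shows "coprod (x + y) = coprod x + coprod y"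
  unfolding coprod_def using assms PBT_subset_span_FF
  by (intro FFd.lin_ext_add) (auto simp: fun_eq_iff algebra_simps)

lemma coprod_scale:
  assumes "x \<in> PBT" shows "coprod (fscale c x) = fscale c (coprod x)"
  unfolding coprod_def using assms PBT_subset_span_FF
  by (intro FFd.lin_ext_scale) (auto simp: fun_eq_iff algebra_simps)

lemma coprod_in_span:
  assumes "x \<in> PBT" shows "coprod x \<in> fun_vs.span (range PP2)"
proof -
  obtain N where N: "\<And>w. length w > N \<Longrightarrow> x w = 0" by (rule PBT_bound[OF assms]) blast
  have "linear_on fscale PBT coprod" by (simp add: linear_on_def coprod_add coprod_scale)
  hence "coprod x = (\<Sum>T | size T \<le> N. fscale (x (tree_word T)) (coprod (PP T)))"
    by (rule linear_on_PBT_expand[OF _ _ assms N]) (simp_all add: fun_vs.scale_zero_left)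
  thus ?thesis by (simp add: fun_vs.span_sum fun_vs.span_scale coprod_PP_in_span)
qed

lemma linear_on_dual_mult: "linear_on (*) PBT (f \<star> g)"
  unfolding linear_on_def dual_mult_def
proof (intro conjI ballI allI)
  let ?L = "lin_ext (*) UNIV PP2 (\<lambda>(S, T). f (PP S) * g (PP T))"
  fix x :: "'a series" assume x: "x \<in> PBT"
  show "(if x + y \<in> PBT then ?L (coprod (x + y)) else 0) =
    (if x \<in> PBT then ?L (coprod x) else 0) + (if y \<in> PBT then ?L (coprod y) else 0)"
    if y: "y \<in> PBT" for y
  proof -
    have "?L (coprod x + coprod y) = ?L (coprod x) + ?L (coprod y)"
      by (rule PP2d.lin_ext_add) (simp_all add: x y coprod_in_span distrib_right)
    thus ?thesis by (simp add: x y PBT_closed coprod_add)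
  qed
  fix c
  have "?L (fscale c (coprod x)) = c * ?L (coprod x)"
    by (rule PP2d.lin_ext_scale) (simp_all add: x coprod_in_span distrib_left)
  moreover have "fscale c x \<in> PBT" using x by (rule PBT_closed(2))
  ultimately show "(if fscale c x \<in> PBT then ?L (coprod (fscale c x)) else 0) =
    c * (if x \<in> PBT then ?L (coprod x) else 0)"
    by (simp add: x coprod_scale)
qed

text \<open>Both sides are linear forms, so it suffices to test them on the basis. There the claim
  is adjointness read with the two arguments of the form interchanged.\<close>

lemma phi_mult: "phi (PP R \<odot> PP S :: 'k::field series) = QQ' R \<star> QQ' S"
proof (rule PBT_forms_eqI)
  have RS: "(PP R \<odot> PP S :: 'k series) \<in> PBT" by (simp add: series_mult_in_PBT)
  show "linear_on (*) PBT (phi (PP R \<odot> PP S :: 'k series))" by (rule linear_on_phi_apply[OF RS])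
  show "linear_on (*) PBT (QQ' R \<star> QQ' S :: 'k form)" by (rule linear_on_dual_mult)
  obtain N where N: "\<And>w. length w > N \<Longrightarrow> (PP R \<odot> PP S :: 'k series) w = 0" by (rule PBT_bound[OF RS]) blast
  show "phi (PP R \<odot> PP S) x = (QQ' R \<star> QQ' S) x" if "x \<notin> PBT" for x :: "'k series"
    using that by (simp add: phi_apply[OF RS N] dual_mult_def)
  fix T
  have "(QQ' R \<star> QQ' S) (PP T :: 'k series) =
    (\<Sum>R' | size R' \<le> size T. \<Sum>S' | size S' \<le> size T.
      deconc_coeff T (canon R') (canon S') * (QQ' R (PP R') * QQ' S (PP S')))"
    unfolding dual_mult_def by (simp add: lin_ext_coprod_PP)
  \<comment> \<open>Symmetry moves the summation trees from the arguments to the indices of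
    \<open>QQ'\<close>, where the adjointness identity applies.\<close>
  also have "\<dots> = (\<Sum>R' | size R' \<le> size T. \<Sum>S' | size S' \<le> size T.
      deconc_coeff T (canon R') (canon S') * (QQ' R' (PP R) * QQ' S' (PP S)))"
    by (intro sum.cong arg_cong2[of _ _ _ _ "(*)"] refl QQ'_PP_sym)
  also have "\<dots> = QQ' T (PP R \<odot> PP S)" by (simp add: sum_deconc_QQ')
  also have "\<dots> = phi (PP R \<odot> PP S) (PP T)" using RS by (simp add: phi_at_PP)
  finally show "phi (PP R \<odot> PP S) (PP T) = (QQ' R \<star> QQ' S) (PP T :: 'k series)" by simp
qed

section \<open>Unit and counit\<close>

lemma series_one_eq: "series_one = PP Leaf"
proof
  fix w :: "nat list"
  have "word_tree w = Leaf \<longleftrightarrow> w = []" by (metis length_0_conv size_word_tree tree.size(3) eq_size_0)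
  thus "series_one w = PP Leaf w" by (auto simp: series_one_def PP_apply)
qed

lemma counit_eq:
  assumes "x \<in> PBT" shows "counit x = x []"
proof -
  obtain N where N: "\<And>w. length w > N \<Longrightarrow> x w = 0" by (rule PBT_bound[OF assms(1)]) blast
  have "counit x = (\<Sum>\<sigma> | is_perm \<sigma> \<and> length \<sigma> \<le> N. x (perm_inv \<sigma>) * (if \<sigma> = [] then 1 else 0))"
    unfolding counit_def using assms PBT_subset_span_FF N
    by (intro FFd.lin_ext_eq) (auto simp: finite_perms)
  also have "\<dots> = (\<Sum>\<sigma> | is_perm \<sigma> \<and> length \<sigma> \<le> N. if \<sigma> = [] then x (perm_inv []) else 0)"
    by (intro sum.cong) auto
  also have "\<dots> = x []" using finite_perms[of N] by (simp add: is_perm_def perm_inv_def)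
  finally show ?thesis .
qed

lemma QQ'_Leaf: "QQ' Leaf x = (if x \<in> PBT then x [] else 0)"
proof -
  have "\<sigma> \<in> tree_class Leaf \<longleftrightarrow> \<sigma> = []" for \<sigma>
    using tree_class_length[of \<sigma> Leaf] by (auto simp: is_perm_def)
  hence "tree_class Leaf = {[]}" by blast
  thus ?thesis by (simp add: QQ'_apply)
qed

lemma phi_series_one: "phi series_one = dual_one"
  by (rule ext) (simp add: series_one_eq phi_PP QQ'_Leaf dual_one_def counit_eq)

lemma dual_counit_phi: "x \<in> PBT \<Longrightarrow> dual_counit (phi x) = counit x"
  by (simp add: dual_counit_def series_one_eq phi_at_PP QQ'_Leaf counit_eq)

subsection \<open>Triangularity\<close>

text \<open>In the diagram of \<open>w\<close> described above, \<open>lows w\<close> lists the rightmost cells of the rows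
  (0 for an empty row), \<open>cols w\<close> is the set of nonempty columns, and entry \<open>i\<close> of \<open>col_counts w\<close>
  counts the columns with a cell below the first \<open>i\<close> rows.\<close>

fun lows :: "nat list \<Rightarrow> nat list" where
  "lows [] = []"
| "lows (a # w) = Max (insert 0 {v \<in> set w. v < a}) # lows w"

fun cols :: "nat list \<Rightarrow> nat set" where
  "cols [] = {}"
| "cols (a # w) = {v \<in> set w. v < a} \<union> cols w"

fun col_counts :: "nat list \<Rightarrow> nat list" where
  "col_counts [] = []"
| "col_counts (a # w) = card (cols (a # w)) # col_counts w"

lemma length_lows [simp]: "length (lows w) = length w"
  by (induction w) auto

lemma length_col_counts [simp]: "length (col_counts w) = length w"
  by (induction w) auto

text \<open>A nonempty column has a larger letter before it, so its letter cannot be the one at the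
  head.\<close>

lemma cols_subset_tl: "cols (a # w) \<subseteq> set w"
  by (induction w arbitrary: a) auto

lemma finite_cols [simp]: "finite (cols w)"
  by (induction w) auto

lemma cols_le_lows: "v \<in> cols w \<Longrightarrow> \<exists>x\<in>set (lows w). v \<le> x"
proof (induction w)
  case (Cons a w)
  have "x \<le> Max (insert 0 {v \<in> set w. v < a})" if "x \<in> set w" "x < a" for x
    using that by (intro Max_ge) auto
  thus ?case using Cons by auto
qed simp

lemma lows_in_cols: "x \<in> set (lows w) \<Longrightarrow> x = 0 \<or> x \<in> cols w"
proof (induction w)
  case (Cons a w)
  have "Max (insert 0 {v \<in> set w. v < a}) \<in> insert 0 {v \<in> set w. v < a}" by (intro Max_in) auto
  thus ?case using Cons by auto
qed simp

lemma rev_sort_Cons: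
  assumes "ls \<noteq> []"
  obtains m ms where "rev (sort ls) = m # ms" "m \<in> set ls" "\<And>x. x \<in> set ls \<Longrightarrow> x \<le> (m::nat)"
proof -
  have "sort ls \<noteq> []" using assms by (metis length_0_conv length_sort)
  then obtain ms m where s: "sort ls = ms @ [m]" by (metis rev_exhaust)
  have "sorted (ms @ [m])" by (metis s sorted_sort)
  moreover have "set ls = set (ms @ [m])" by (metis s set_sort)
  ultimately have "m \<in> set ls" "\<And>x. x \<in> set ls \<Longrightarrow> x \<le> m" by (auto simp: sorted_append)
  thus ?thesis using that[of m "rev ms"] s by auto
qed

text \<open>If the two heads agree, then the columns are \<open>1, \<dots>, m\<close>, so the first letter exceeds
  \<open>m\<close> and the first row is a longest one; it can be removed.\<close>

lemma col_counts_le_lows: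
  assumes "distinct w" "0 \<notin> set w"
  shows "col_counts w \<le> rev (sort (lows w))"
  using assms
proof (induction w)
  case (Cons a w)
  obtain m ms where m: "rev (sort (lows (a # w))) = m # ms" "m \<in> set (lows (a # w))"
    "\<And>x. x \<in> set (lows (a # w)) \<Longrightarrow> x \<le> m"
    by (rule rev_sort_Cons[of "lows (a # w)"]) auto
  have sub: "cols (a # w) \<subseteq> {1..m}"
  proof
    fix v assume v: "v \<in> cols (a # w)"
    have "v \<noteq> 0" using v cols_subset_tl[of a w] Cons.prems by (metis list.set_intros(2) subsetD)
    moreover obtain x where "x \<in> set (lows (a # w))" "v \<le> x" using cols_le_lows[OF v] by auto
    ultimately show "v \<in> {1..m}" using m(3)[of x] by auto
  qed
  hence "card (cols (a # w)) \<le> m" using card_mono[OF _ sub] by simp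
  moreover have "col_counts (a # w) \<le> m # ms" if eq: "card (cols (a # w)) = m"
  proof -
    have cols: "cols (a # w) = {1..m}" using sub eq by (intro card_subset_eq) auto
    have "a \<notin> {1..m}" using cols cols_subset_tl[of a w] Cons.prems(1) by auto
    hence am: "a > m" using Cons.prems(2) by auto
    have hd: "Max (insert 0 {v \<in> set w. v < a}) = m"
    proof (rule antisym)
      show "Max (insert 0 {v \<in> set w. v < a}) \<le> m" by (rule m(3)) simp
      have "m = 0 \<or> m \<in> set w" using cols cols_subset_tl[of a w] by (cases "m = 0") auto
      thus "m \<le> Max (insert 0 {v \<in> set w. v < a})" using am by (intro Max_ge) auto
    qed
    have "\<forall>x\<in>set (lows w). x \<le> m" using m(3) by simp
    hence "sort (lows (a # w)) = sort (lows w) @ [m]"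
      by (intro properties_for_sort) (auto simp: hd sorted_append)
    hence "ms = rev (sort (lows w))" using m(1) by simp
    thus ?thesis using Cons eq by simp
  qed
  ultimately show ?case unfolding m(1) by (auto simp: less_le)
qed simp

text \<open>The diagram is a Young diagram.\<close>

fun dominant :: "nat list \<Rightarrow> bool" where
  "dominant [] = True"
| "dominant (a # w) = ((\<exists>m. {v \<in> set w. v < a} = {1..m} \<and> (\<forall>x\<in>set (lows w). x \<le> m)) \<and> dominant w)"

lemma Max_insert_0_atLeastAtMost: "Max (insert 0 {1..m::nat}) = m"
  by (rule Max_eqI) auto

text \<open>In a Young diagram the first row meets every column, so counting columns from a row
  onwards gives the length of that row, and the lengths decrease weakly.\<close>

lemma dominant_lows:
  assumes "dominant w" "0 \<notin> set w"
  shows "col_counts w = lows w \<and> sorted (rev (lows w))"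
  using assms
proof (induction w)
  case (Cons a w)
  then obtain m where m: "{v \<in> set w. v < a} = {1..m}" "\<forall>x\<in>set (lows w). x \<le> m" by auto
  have "cols w \<subseteq> {1..m}"
  proof
    fix v assume v: "v \<in> cols w"
    have "cols w \<subseteq> set w" using cols_subset_tl by (cases w) auto
    hence "v \<noteq> 0" using v Cons.prems by (metis list.set_intros(2) subsetD)
    thus "v \<in> {1..m}" using cols_le_lows[OF v] m(2) by force
  qed
  hence "cols (a # w) = {1..m}" using m(1) by auto
  thus ?case using Cons m Max_insert_0_atLeastAtMost[of m] by (auto simp: sorted_append)
qed simp

lemma lows_shift_append:
  assumes "set v = {1..k}" "0 \<notin> set u"
  shows "lows (map (\<lambda>i. i + k) u @ v) = map (\<lambda>i. i + k) (lows u) @ lows v"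
  using assms(2)
proof (induction u)
  case (Cons a u)
  define m where "m = Max (insert 0 {x \<in> set u. x < a})"
  have m: "m \<in> insert 0 {x \<in> set u. x < a}" "\<And>x. x \<in> insert 0 {x \<in> set u. x < a} \<Longrightarrow> x \<le> m"
    unfolding m_def by (rule Max_in, simp, simp, rule Max_ge, simp)
  have "Max (insert 0 {x \<in> set (map (\<lambda>i. i + k) u @ v). x < a + k}) = m + k"
  proof (rule Max_eqI)
    fix y assume "y \<in> insert 0 {x \<in> set (map (\<lambda>i. i + k) u @ v). x < a + k}"
    thus "y \<le> m + k" using m(2) assms(1) by auto
  next
    \<comment> \<open>If the row was empty before the shift, its rightmost cell is now
      \<open>k\<close>, the largest letter of \<open>v\<close>, or 0 if \<open>v\<close> is
      empty.\<close>
    show "m + k \<in> insert 0 {x \<in> set (map (\<lambda>i. i + k) u @ v). x < a + k}"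
      using m(1) assms(1) Cons.prems by (cases "k = 0") auto
  qed simp
  thus ?case using Cons by (simp add: m_def)
qed simp

lemma dominant_shift_append:
  assumes "set v = {1..k}" "0 \<notin> set u" "dominant u" "dominant v"
  shows "dominant (map (\<lambda>i. i + k) u @ v)"
  using assms(2,3)
proof (induction u)
  case (Cons a u)
  then obtain m where m: "{x \<in> set u. x < a} = {1..m}" "\<forall>x\<in>set (lows u). x \<le> m" by auto
  have "{x \<in> set (map (\<lambda>i. i + k) u @ v). x < a + k} = (\<lambda>i. i + k) ` {x \<in> set u. x < a} \<union> {1..k}"
    using assms(1) Cons.prems by auto
  also have "\<dots> = {1..m + k}" unfolding m(1) by (auto simp: image_iff Bex_def)
  finally have *: "{x \<in> set (map (\<lambda>i. i + k) u @ v). x < a + k} = {1..m + k}" .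
  have "x \<le> m + k" if "x \<in> set (lows (map (\<lambda>i. i + k) u @ v))" for x
  proof -
    have "cols v \<subseteq> {1..k}" using cols_subset_tl assms(1) by (cases v) fastforce+
    hence "\<forall>y\<in>set (lows v). y \<le> k" using lows_in_cols[of _ v] by fastforce
    thus ?thesis using that m(2) Cons.prems assms(1) by (auto simp: lows_shift_append)
  qed
  thus ?case using * Cons by auto
qed (simp add: assms)

lemma dominant_snoc:
  assumes "dominant w" "\<forall>x\<in>set w. x < k"
  shows "dominant (w @ [k]) \<and> lows (w @ [k]) = lows w @ [0]"
  using assms
proof (induction w)
  case (Cons a w)
  have "{v \<in> set (w @ [k]). v < a} = {v \<in> set w. v < a}" using Cons.prems by auto
  thus ?case using Cons by auto
qed (auto intro: exI[of _ 0])

text \<open>By the recursive form of \<open>canon\<close>: appending a largest letter adds an empty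
  row, and putting a shifted word in front lengthens each of its rows by the number of letters
  behind it.\<close>

lemma dominant_canon: "dominant (canon T)"
proof (induction T)
  case (Node l a r)
  have l: "set (canon l) = {1..size l}" using is_perm_canon[of l] by (simp add: is_perm_def)
  have "dominant (map (\<lambda>i. i + Suc (size l)) (canon r) @ canon l @ [Suc (size l)])"
  proof (rule dominant_shift_append)
    show "dominant (canon l @ [Suc (size l)])" using Node l dominant_snoc[of "canon l"] by auto
    show "set (canon l @ [Suc (size l)]) = {1..Suc (size l)}" using l by auto
  qed (use Node pos_word_perm[OF is_perm_canon] in auto)
  thus ?case by simp
qed simp

text \<open>The numbers of nodes to the left of the subtrees, in preorder. Up to order these are the
  \<open>lows\<close> of the permutations in the class of the tree.\<close>

fun offsets :: "unit tree \<Rightarrow> nat \<Rightarrow> nat list" where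
  "offsets Leaf k = []"
| "offsets (Node l a r) k = k # offsets l k @ offsets r (Suc (k + size l))"

lemma length_offsets [simp]: "length (offsets T k) = size T"
  by (induction T arbitrary: k) auto

lemma offsets_bounds: "x \<in> set (offsets T k) \<Longrightarrow> k \<le> x \<and> x < k + size T"
  by (induction T arbitrary: k) fastforce+

lemma sorted_offsets: "sorted (offsets T k)"
  by (induction T arbitrary: k) (fastforce simp: sorted_append dest: offsets_bounds)+

text \<open>The nodes to the left of a subtree all precede its root in preorder.\<close>

lemma offsets_nth_le: "i < size T \<Longrightarrow> offsets T k ! i \<le> k + i"
proof (induction T arbitrary: i k)
  case (Node l a r)
  show ?case
  proof (cases i)
    case (Suc j)
    show ?thesis
    proof (cases "j < size l")
      case True
      thus ?thesis using Suc Node.IH(1)[of j k] by (simp add: nth_append)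
    next
      case False
      hence "offsets r (Suc (k + size l)) ! (j - size l) \<le> Suc (k + size l) + (j - size l)"
        using Suc Node.prems by (intro Node.IH(2)) auto
      thus ?thesis using Suc False by (simp add: nth_append)
    qed
  qed simp
qed simp

lemma offsets_inj: "offsets S k = offsets T k \<Longrightarrow> S = T"
proof (induction S arbitrary: T k)
  case Leaf
  thus ?case by (cases T) auto
next
  case (Node l a r)
  then obtain l' b r' where T: "T = Node l' b r'" by (cases T) auto
  have eq: "offsets l k @ offsets r (Suc (k + size l)) = offsets l' k @ offsets r' (Suc (k + size l'))"
    using Node.prems T by simp
  have not_less: "\<not> size s < size s'"
    if "offsets s k @ offsets t (Suc (k + size s)) = offsets s' k @ offsets t' (Suc (k + size s'))"
    for s t s' t'
  proof
    assume less: "size s < size s'"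
    have "size s + size t = size s' + size t'" using arg_cong[OF that, of length] by simp
    hence t: "t \<noteq> Leaf" using less by auto
    \<comment> \<open>At this index one list reaches the root of the right subtree, while the other
      is still inside the larger left subtree, where entries are too small.\<close>
    have "(offsets s k @ offsets t (Suc (k + size s))) ! size s = Suc (k + size s)"
      using t by (cases t) (auto simp: nth_append)
    moreover have "(offsets s' k @ offsets t' (Suc (k + size s'))) ! size s \<le> k + size s"
      using less offsets_nth_le[of "size s" s' k] by (simp add: nth_append)
    ultimately show False using that by simp
  qed
  have "size l = size l'" using not_less[OF eq] not_less[OF eq[symmetric]] by simp
  thus ?case using eq Node.IH T by auto
qed

text \<open>Reads labels in place of sizes: each node is given the largest label to the left of its
  subtree, or \<open>k\<close>. This stays meaningful during insertion, when the labels do not yet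
  form an interval.\<close>

fun label_offsets :: "nat tree \<Rightarrow> nat \<Rightarrow> nat list" where
  "label_offsets Leaf k = []"
| "label_offsets (Node l a r) k = k # label_offsets l k @ label_offsets r a"

text \<open>Insertion creates one new node without changing the entries of the old ones. The new
  entry is the largest label below \<open>x\<close>, which is the entry that \<open>lows\<close>
  puts in front for a new first letter.\<close>

lemma mset_label_offsets_insert:
  assumes "sorted (inorder t)" "distinct (inorder t)" "\<forall>y\<in>set_tree t. k < y" "k < x" "x \<notin> set_tree t"
  shows "mset (label_offsets (bst_insert x t) k) =
    add_mset (Max (insert k {y \<in> set_tree t. y < x})) (mset (label_offsets t k))"
  using assms
proof (induction t arbitrary: k)
  case (Node l a r)
  have la: "\<forall>y\<in>set_tree l. y < a" and ra: "\<forall>y\<in>set_tree r. a < y"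
    using Node.prems(1,2) by (auto simp: sorted_append nat_less_le)
  show ?case
  proof (cases "x \<le> a")
    case True
    have eq: "{y \<in> set_tree (Node l a r). y < x} = {y \<in> set_tree l. y < x}" using True la ra by auto
    have IH: "mset (label_offsets (bst_insert x l) k) =
        add_mset (Max (insert k {y \<in> set_tree l. y < x})) (mset (label_offsets l k))"
      by (rule Node.IH(1)) (use Node.prems in \<open>auto simp: sorted_append\<close>)
    show ?thesis using True IH unfolding eq by simp
  next
    case False
    \<comment> \<open>The root label exceeds \<open>k\<close> and all labels on the left, so it
      takes over the part of the default value.\<close>
    have "Max (insert k {y \<in> set_tree (Node l a r). y < x}) = Max (insert a {y \<in> set_tree r. y < x})"
    proof (rule Max_eqI)
      have "Max (insert a {y \<in> set_tree r. y < x}) \<in> insert a {y \<in> set_tree r. y < x}"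
        by (rule Max_in) auto
      thus "Max (insert a {y \<in> set_tree r. y < x}) \<in> insert k {y \<in> set_tree (Node l a r). y < x}"
        using False by auto
      fix y assume y: "y \<in> insert k {y \<in> set_tree (Node l a r). y < x}"
      have "a \<le> Max (insert a {y \<in> set_tree r. y < x})" by (rule Max_ge) auto
      moreover have "y \<le> a \<or> y \<in> {y \<in> set_tree r. y < x}" using y la Node.prems(3) by auto
      moreover have "y \<le> Max (insert a {y \<in> set_tree r. y < x})" if "y \<in> {y \<in> set_tree r. y < x}"
        using that by (intro Max_ge) auto
      ultimately show "y \<le> Max (insert a {y \<in> set_tree r. y < x})" by (meson le_trans)
    qed simp
    moreover have "mset (label_offsets (bst_insert x r) a) =
        add_mset (Max (insert a {y \<in> set_tree r. y < x})) (mset (label_offsets r a))"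
      by (rule Node.IH(2)) (use Node.prems False ra in \<open>auto simp: sorted_append\<close>)
    ultimately show ?thesis using False by simp
  qed
qed simp

lemma mset_lows:
  assumes "distinct w" "0 \<notin> set w"
  shows "mset (label_offsets (bst_of w) 0) = mset (lows w)"
  using assms
proof (induction w)
  case (Cons a w)
  have "mset (label_offsets (bst_insert a (bst_of w)) 0) =
    add_mset (Max (insert 0 {y \<in> set_tree (bst_of w). y < a})) (mset (label_offsets (bst_of w) 0))"
    using Cons.prems by (intro mset_label_offsets_insert) (auto simp: inorder_bst_of intro!: gr0I)
  thus ?case using Cons by simp
qed simp

lemma label_offsets_eq:
  "inorder t = [Suc k..<Suc k + size t] \<Longrightarrow> label_offsets t k = offsets (shape t) k"
proof (induction t arbitrary: k)
  case (Node l a r)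
  let ?n = "size l"
  have split: "[Suc k..<Suc k + size (Node l a r)] =
    [Suc k..<Suc k + ?n] @ (Suc k + ?n) # [Suc (Suc k + ?n)..<Suc (Suc k + ?n) + size r]"
  proof -
    have "[Suc k..<Suc k + ?n + Suc (size r)] = [Suc k..<Suc k + ?n] @ [Suc k + ?n..<Suc k + ?n + Suc (size r)]"
      by (rule upt_add_eq_append) simp
    moreover have "[Suc k + ?n..<Suc k + ?n + Suc (size r)] =
        (Suc k + ?n) # [Suc (Suc k + ?n)..<Suc (Suc k + ?n) + size r]"
      by (simp add: upt_conv_Cons del: upt_Suc)
    ultimately show ?thesis by (simp add: add.assoc del: upt_Suc)
  qed
  have "inorder l = [Suc k..<Suc k + ?n] \<and> a = Suc k + ?n \<and>
    inorder r = [Suc (Suc k + ?n)..<Suc (Suc k + ?n) + size r]"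
    using Node.prems unfolding split by (simp add: append_eq_append_conv del: upt_Suc)
  thus ?case using Node.IH by simp
qed simp

lemma sort_lows_perm:
  assumes "is_perm \<sigma>" shows "sort (lows \<sigma>) = offsets (shape (bst_of \<sigma>)) 0"
proof (rule properties_for_sort)
  have "inorder (bst_of \<sigma>) = [Suc 0..<Suc 0 + size (bst_of \<sigma>)]"
    using sort_perm[OF assms] by (simp add: inorder_bst_of del: upt_Suc)
  hence "label_offsets (bst_of \<sigma>) 0 = offsets (shape (bst_of \<sigma>)) 0" by (rule label_offsets_eq)
  moreover have "mset (label_offsets (bst_of \<sigma>) 0) = mset (lows \<sigma>)"
    using assms by (intro mset_lows pos_word_perm) (auto simp: is_perm_def)
  ultimately show "mset (offsets (shape (bst_of \<sigma>)) 0) = mset (lows \<sigma>)" by simp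
qed (rule sorted_offsets)

section \<open>Transposition of the diagram under inversion\<close>

lemma mem_cols_iff: "v \<in> cols w \<longleftrightarrow> (\<exists>p<length w. \<exists>q<p. w ! p = v \<and> v < w ! q)"
proof (induction w)
  case (Cons a w)
  show ?case
  proof
    assume "v \<in> cols (a # w)"
    then consider p where "p < length w" "w ! p = v" "v < a"
      | p q where "p < length w" "q < p" "w ! p = v" "v < w ! q"
      using Cons by (auto simp: in_set_conv_nth)
    thus "\<exists>p<length (a # w). \<exists>q<p. (a # w) ! p = v \<and> v < (a # w) ! q"
    proof cases
      case 1
      thus ?thesis by (intro exI[of _ "Suc p"] conjI exI[of _ 0]) auto
    next
      case 2
      thus ?thesis by (intro exI[of _ "Suc p"] conjI exI[of _ "Suc q"]) auto
    qed
  next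
    assume "\<exists>p<length (a # w). \<exists>q<p. (a # w) ! p = v \<and> v < (a # w) ! q"
    then obtain p q where pq: "p < length (a # w)" "q < p" "(a # w) ! p = v" "v < (a # w) ! q" by auto
    then obtain p' where p': "p = Suc p'" by (cases p) auto
    show "v \<in> cols (a # w)"
    proof (cases q)
      case 0
      thus ?thesis using pq p' by auto
    next
      case (Suc q')
      hence "v \<in> cols w" using pq p' Cons by auto
      thus ?thesis by simp
    qed
  qed
qed simp

lemma col_counts_nth: "i < length w \<Longrightarrow> col_counts w ! i = card (cols (drop i w))"
proof (induction w arbitrary: i)
  case (Cons a w)
  thus ?case by (cases i) auto
qed simp

text \<open>The default 0 of an empty row exceeds no \<open>i\<close>, so a strict comparison with
  the maximum always has a genuine cell as witness.\<close>

lemma lows_nth_gt_iff: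
  "v < length w \<Longrightarrow> i < lows w ! v \<longleftrightarrow> (\<exists>u. v < u \<and> u < length w \<and> w ! u < w ! v \<and> i < w ! u)"
proof (induction w arbitrary: v)
  case (Cons a w)
  show ?case
  proof (cases v)
    case 0
    have "i < Max (insert 0 {v \<in> set w. v < a}) \<longleftrightarrow> (\<exists>y\<in>set w. y < a \<and> i < y)"
      by (subst Max_gr_iff) auto
    also have "\<dots> \<longleftrightarrow> (\<exists>u<length w. w ! u < a \<and> i < w ! u)" by (metis in_set_conv_nth)
    also have "\<dots> \<longleftrightarrow> (\<exists>u. 0 < u \<and> u < length (a # w) \<and> (a # w) ! u < a \<and> i < (a # w) ! u)"
      by (auto simp: less_Suc_eq_0_disj gr0_conv_Suc)
    finally show ?thesis using 0 by simp
  next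
    case (Suc v')
    hence "i < lows w ! v' \<longleftrightarrow> (\<exists>u. v' < u \<and> u < length w \<and> w ! u < w ! v' \<and> i < w ! u)"
      using Cons by auto
    also have "\<dots> \<longleftrightarrow> (\<exists>u. Suc v' < u \<and> u < length (a # w) \<and> (a # w) ! u < w ! v' \<and> i < (a # w) ! u)"
    proof
      assume "\<exists>u. v' < u \<and> u < length w \<and> w ! u < w ! v' \<and> i < w ! u"
      then obtain u where "v' < u" "u < length w" "w ! u < w ! v'" "i < w ! u" by blast
      thus "\<exists>u. Suc v' < u \<and> u < length (a # w) \<and> (a # w) ! u < w ! v' \<and> i < (a # w) ! u"
        by (intro exI[of _ "Suc u"]) auto
    next
      assume "\<exists>u. Suc v' < u \<and> u < length (a # w) \<and> (a # w) ! u < w ! v' \<and> i < (a # w) ! u"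
      then obtain u where "Suc v' < u" "u < length (a # w)" "(a # w) ! u < w ! v'" "i < (a # w) ! u" by blast
      thus "\<exists>u. v' < u \<and> u < length w \<and> w ! u < w ! v' \<and> i < w ! u"
        by (intro exI[of _ "u - 1"]) (cases u; auto)
    qed
    finally show ?thesis using Suc by simp
  qed
qed simp

text \<open>Inversion transposes the diagram: the columns of \<open>\<sigma>\<close> are the rows of its inverse.\<close>

lemma col_counts_perm_inv:
  assumes "is_perm \<sigma>" "i < length \<sigma>"
  shows "col_counts \<sigma> ! i = length (filter (\<lambda>x. i < x) (lows (perm_inv \<sigma>)))"
proof -
  let ?\<tau> = "perm_inv \<sigma>"
  let ?n = "length \<sigma>"
  have \<tau>: "is_perm ?\<tau>" using assms by simp
  have "cols (drop i \<sigma>) = Suc ` {v. v < ?n \<and> i < lows ?\<tau> ! v}"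
  proof (intro equalityI subsetI)
    fix y assume "y \<in> cols (drop i \<sigma>)"
    then obtain p q where pq: "p < length (drop i \<sigma>)" "q < p" "drop i \<sigma> ! p = y" "y < drop i \<sigma> ! q"
      by (auto simp: mem_cols_iff)
    let ?p = "i + p" and ?q = "i + q"
    have P: "?p < ?n" "?q < ?n" "\<sigma> ! ?p = y" "y < \<sigma> ! ?q" using pq by auto
    note p = perm_inv_nth[OF assms(1) P(1)] and q = perm_inv_nth[OF assms(1) P(2)]
    have "i < lows ?\<tau> ! (y - 1)"
      using p q P pq by (subst lows_nth_gt_iff) (auto intro!: exI[of _ "\<sigma> ! ?q - 1"])
    thus "y \<in> Suc ` {v. v < ?n \<and> i < lows ?\<tau> ! v}" using p P by (intro image_eqI[of _ _ "y - 1"]) auto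
  next
    fix y assume "y \<in> Suc ` {v. v < ?n \<and> i < lows ?\<tau> ! v}"
    then obtain v where v: "y = Suc v" "v < ?n" "i < lows ?\<tau> ! v" by auto
    then obtain u where u: "v < u" "u < ?n" "?\<tau> ! u < ?\<tau> ! v" "i < ?\<tau> ! u"
      by (auto simp: lows_nth_gt_iff)
    obtain p where p: "p < ?n" "?\<tau> ! v = Suc p" "\<sigma> ! p = Suc v" using perm_inv_nth_ex[OF assms(1) v(2)] by auto
    obtain q where q: "q < ?n" "?\<tau> ! u = Suc q" "\<sigma> ! q = Suc u" using perm_inv_nth_ex[OF assms(1) u(2)] by auto
    show "y \<in> cols (drop i \<sigma>)" unfolding mem_cols_iff
      using p q u v assms(2) by (intro exI[of _ "p - i"] conjI exI[of _ "q - i"]) auto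
  qed
  hence "col_counts \<sigma> ! i = card {v. v < ?n \<and> i < lows ?\<tau> ! v}"
    using assms by (simp add: col_counts_nth card_image)
  thus ?thesis by (simp add: length_filter_conv_card)
qed

definition tree_key :: "unit tree \<Rightarrow> nat list" where
  "tree_key T = rev (offsets T 0)"

definition tree_conj_key :: "unit tree \<Rightarrow> nat list" where
  "tree_conj_key T = map (\<lambda>i. length (filter (\<lambda>x. i < x) (offsets T 0))) [0..<size T]"

text \<open>The column paired with row \<open>T\<close> in the matrix of \<open>phi\<close>;
  \<open>canon T\<close> accounts for its nonzero entry there.\<close>

definition tree_star :: "unit tree \<Rightarrow> unit tree" where
  "tree_star T = shape (bst_of (perm_inv (canon T)))"

lemma inj_tree_key: "inj tree_key"
  by (rule injI) (auto simp: tree_key_def intro: offsets_inj)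

lemma col_counts_perm:
  assumes "is_perm \<sigma>"
  shows "col_counts \<sigma> = tree_conj_key (shape (bst_of (perm_inv \<sigma>)))"
proof (rule nth_equalityI)
  fix i assume "i < length (col_counts \<sigma>)"
  hence i: "i < length \<sigma>" by simp
  have "length (filter (\<lambda>x. i < x) (lows (perm_inv \<sigma>))) = length (filter (\<lambda>x. i < x) (sort (lows (perm_inv \<sigma>))))"
    by (metis mset_filter mset_sort size_mset)
  thus "col_counts \<sigma> ! i = tree_conj_key (shape (bst_of (perm_inv \<sigma>))) ! i"
    using i assms by (simp add: col_counts_perm_inv sort_lows_perm tree_conj_key_def)
qed (simp add: tree_conj_key_def)

lemma tree_conj_key_le:
  assumes "is_perm \<sigma>"
  shows "tree_conj_key (shape (bst_of (perm_inv \<sigma>))) \<le> tree_key (shape (bst_of \<sigma>))"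
  using col_counts_le_lows[of \<sigma>] assms pos_word_perm[OF assms]
  by (simp add: col_counts_perm sort_lows_perm tree_key_def is_perm_def)

text \<open>The diagram of \<open>canon T\<close> is a Young diagram, so the inequality between the
  two keys becomes an equality.\<close>

lemma tree_conj_key_star: "tree_conj_key (tree_star T) = tree_key T"
proof -
  have "col_counts (canon T) = lows (canon T)" and srt: "sorted (rev (lows (canon T)))"
    using dominant_lows[OF dominant_canon pos_word_perm[OF is_perm_canon]] by auto
  moreover have "sort (lows (canon T)) = rev (lows (canon T))"
    by (rule properties_for_sort) (simp_all add: srt)
  ultimately show ?thesis
    using sort_lows_perm[OF is_perm_canon[of T]] col_counts_perm[OF is_perm_canon[of T]]
    by (simp add: tree_star_def tree_key_def)
qed

lemma size_tree_star [simp]: "size (tree_star T) = size T"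
  by (simp add: tree_star_def)

section \<open>The matrix of \<open>phi\<close>\<close>

lemma QQ'_PP_card:
  "QQ' T (PP S :: 'k::field series) = of_nat (card {\<sigma> \<in> tree_class T. shape (bst_of (perm_inv \<sigma>)) = S})"
proof -
  have "QQ' T (PP S :: 'k series) = (\<Sum>\<sigma>\<in>tree_class T. if shape (bst_of (perm_inv \<sigma>)) = S then 1 else 0)"
    using pos_word_perm by (auto simp: QQ'_apply PP_apply word_tree_perm intro!: sum.cong)
  thus ?thesis by (simp add: sum.If_cases Int_def conj_assoc)
qed

text \<open>The entry counts a finite set containing \<open>canon T\<close>, and in characteristic 0
  a positive count is a nonzero scalar.\<close>

lemma QQ'_PP_star_nonzero: "QQ' T (PP (tree_star T) :: 'k::field_char_0 series) \<noteq> 0"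
proof -
  have "canon T \<in> {\<sigma> \<in> tree_class T. shape (bst_of (perm_inv \<sigma>)) = tree_star T}"
    by (simp add: tree_star_def)
  moreover have "finite {\<sigma> \<in> tree_class T. shape (bst_of (perm_inv \<sigma>)) = tree_star T}"
    by (rule finite_subset[OF _ finite_tree_class[of T]]) auto
  ultimately have "card {\<sigma> \<in> tree_class T. shape (bst_of (perm_inv \<sigma>)) = tree_star T} \<noteq> 0"
    using card_0_eq by blast
  thus ?thesis unfolding QQ'_PP_card by (simp only: of_nat_eq_0_iff) simp
qed

lemma QQ'_PP_star_triangular:
  assumes "QQ' S (PP (tree_star T) :: 'k::field series) \<noteq> 0"
  shows "tree_key T \<le> tree_key S"
proof -
  have "{\<sigma> \<in> tree_class S. shape (bst_of (perm_inv \<sigma>)) = tree_star T} \<noteq> {}"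
    using assms unfolding QQ'_PP_card by (metis (no_types, lifting) card.empty of_nat_0)
  then obtain \<sigma> where "is_perm \<sigma>" "shape (bst_of \<sigma>) = S" "shape (bst_of (perm_inv \<sigma>)) = tree_star T"
    by auto
  thus ?thesis using tree_conj_key_le[of \<sigma>] by (simp add: tree_conj_key_star)
qed

lemma inj_tree_star: "inj tree_star"
  by (rule injI) (metis inj_tree_key injD tree_conj_key_star)

subsection \<open>Bijectivity\<close>

text \<open>The unknown with the least key occurs in its own equation only. The remaining system is
  solved by induction, and that unknown is then fixed by dividing by the diagonal entry.\<close>

lemma triangular_system_solvable:
  fixes A :: "'i \<Rightarrow> 'i \<Rightarrow> 'k::field" and key :: "'i \<Rightarrow> 'o::linorder"
  assumes "finite I" "inj_on key I" "\<And>i. i \<in> I \<Longrightarrow> A i i \<noteq> 0"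
    and "\<And>i j. i \<in> I \<Longrightarrow> j \<in> I \<Longrightarrow> A i j \<noteq> 0 \<Longrightarrow> key i \<le> key j"
  shows "\<exists>c. \<forall>i\<in>I. (\<Sum>j\<in>I. A i j * c j) = f i"
  using assms
proof (induction "card I" arbitrary: I)
  case 0
  thus ?case by auto
next
  case (Suc n)
  have "key ` I \<noteq> {}" using Suc by auto
  hence "Min (key ` I) \<in> key ` I" using Suc.prems(1) by (intro Min_in) auto
  then obtain m where m: "m \<in> I" "key m = Min (key ` I)" by auto
  have least: "key m \<le> key i" if "i \<in> I" for i using that m(2) Suc.prems(1) by simp
  have "\<exists>c. \<forall>i\<in>I - {m}. (\<Sum>j\<in>I - {m}. A i j * c j) = f i"
    using Suc.prems Suc.hyps m by (intro Suc.hyps(1)) (auto intro: inj_on_subset)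
  then obtain c where c: "\<forall>i\<in>I - {m}. (\<Sum>j\<in>I - {m}. A i j * c j) = f i" by blast
  define d where "d = c(m := (f m - (\<Sum>j\<in>I - {m}. A m j * c j)) / A m m)"
  have sum: "(\<Sum>j\<in>I. A i j * d j) = A i m * d m + (\<Sum>j\<in>I - {m}. A i j * c j)" for i
  proof -
    have "(\<Sum>j\<in>I. A i j * d j) = A i m * d m + (\<Sum>j\<in>I - {m}. A i j * d j)"
      using Suc.prems(1) m(1) by (rule sum.remove)
    also have "(\<Sum>j\<in>I - {m}. A i j * d j) = (\<Sum>j\<in>I - {m}. A i j * c j)"
      by (intro sum.cong) (auto simp: d_def)
    finally show ?thesis .
  qed
  have "(\<Sum>j\<in>I. A i j * d j) = f i" if i: "i \<in> I" for i
  proof (cases "i = m")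
    case True
    thus ?thesis using Suc.prems(3)[OF m(1)] unfolding sum by (simp add: d_def)
  next
    case False
    have "A i m = 0"
    proof (rule ccontr)
      assume "A i m \<noteq> 0"
      hence "key i = key m" using Suc.prems(4)[OF i m(1)] least[OF i] by (metis antisym)
      thus False using False inj_onD[OF Suc.prems(2) _ i m(1)] by blast
    qed
    thus ?thesis using c i False unfolding sum by simp
  qed
  thus ?case by blast
qed

lemma phi_at_PP_expand:
  assumes "x \<in> PBT" "\<And>w. length w > N \<Longrightarrow> x w = 0"
  shows "phi x (PP S) = (\<Sum>T | size T \<le> N. x (tree_word T) * QQ' T (PP S))"
proof -
  have "phi x = (\<Sum>T | size T \<le> N. fscale (x (tree_word T)) (QQ' T))"
    unfolding phi_PP[symmetric]
    by (rule linear_on_PBT_expand[OF linear_on_phi _ assms]) (simp_all add: fun_vs.scale_zero_left)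
  thus ?thesis by (simp add: sum_fun_apply)
qed

lemma phi_eq_0:
  assumes x: "(x :: 'k::field_char_0 series) \<in> PBT" and "phi x = 0"
  shows "x = 0"
proof (rule ccontr)
  assume "x \<noteq> 0"
  obtain N where N: "\<And>w. length w > N \<Longrightarrow> x w = 0" by (rule PBT_bound[OF x]) blast
  let ?I = "{T. size T \<le> N \<and> x (tree_word T) \<noteq> 0}"
  have fin: "finite ?I" by (rule finite_subset[OF _ finite_trees[of N]]) auto
  have "?I \<noteq> {}"
  proof
    assume "?I = {}"
    hence "(\<Sum>T | size T \<le> N. fscale (x (tree_word T)) (PP T :: 'k series)) = 0"
      by (intro sum.neutral) (auto simp: fun_eq_iff)
    thus False using PBT_expand[OF x N] \<open>x \<noteq> 0\<close> by simp
  qed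
  \<comment> \<open>Let \<open>T\<close> have the largest key in the support. Trees contributing at
    \<open>PP (tree_star T)\<close> have keys at least that of \<open>T\<close>, so this test
    isolates the coefficient of \<open>T\<close>.\<close>
  hence "Max (tree_key ` ?I) \<in> tree_key ` ?I" using fin by (intro Max_in) auto
  then obtain T where T: "T \<in> ?I" "tree_key T = Max (tree_key ` ?I)" by auto
  have "phi x (PP (tree_star T)) = (\<Sum>S | size S \<le> N. x (tree_word S) * QQ' S (PP (tree_star T)))"
    by (rule phi_at_PP_expand[OF x N])
  also have "\<dots> = (\<Sum>S\<in>{T}. x (tree_word S) * QQ' S (PP (tree_star T)))"
  proof (rule sum.mono_neutral_right)
    show "\<forall>S\<in>{T. size T \<le> N} - {T}. x (tree_word S) * QQ' S (PP (tree_star T)) = 0"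
    proof (rule ballI, rule ccontr)
      fix S assume S: "S \<in> {T. size T \<le> N} - {T}" "x (tree_word S) * QQ' S (PP (tree_star T)) \<noteq> 0"
      hence "tree_key T \<le> tree_key S" by (auto intro: QQ'_PP_star_triangular)
      moreover have "tree_key S \<le> tree_key T" unfolding T(2) using S fin by (intro Max_ge) auto
      ultimately have "S = T" using inj_tree_key by (metis antisym injD)
      thus False using S by simp
    qed
  qed (use T finite_trees in auto)
  also have "\<dots> \<noteq> 0" using T QQ'_PP_star_nonzero[of T, where 'k = 'k] by simp
  finally show False using assms(2) by simp
qed

lemma PBT_deg_vanish:
  assumes "x \<in> PBT_deg n" "length w \<noteq> n" shows "x w = 0"
  using assms(1) unfolding PBT_deg_def
proof (induction rule: fun_vs.span_induct_alt)
  case (step c b y)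
  then obtain T where T: "b = PP T" "size T = n" by auto
  hence "word_tree w \<noteq> T" using assms(2) by auto
  thus ?case using step.IH by (simp add: T PP_apply)
qed simp

lemma phi_in_PBT_dual:
  assumes x: "x \<in> PBT" shows "phi x \<in> PBT_dual"
proof -
  obtain N where N: "\<And>w. length w > N \<Longrightarrow> x w = 0" by (rule PBT_bound[OF x]) blast
  have "phi x z = 0" if "n > N" "z \<in> PBT_deg n" for n z
    using that PBT_deg_vanish[OF that(2)]
    by (auto simp: phi_apply[OF x N] intro!: sum.neutral)
  moreover have "phi x z = 0" if "z \<notin> PBT" for z using that by (simp add: phi_apply[OF x N])
  ultimately show ?thesis using linear_on_phi_apply[OF x] unfolding PBT_dual_def by blast
qed

lemma phi_surj:
  assumes f: "(f :: 'k::field_char_0 form) \<in> PBT_dual"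
  shows "\<exists>x\<in>PBT. phi x = f"
proof -
  obtain N where N: "\<And>n x. n > N \<Longrightarrow> x \<in> PBT_deg n \<Longrightarrow> f x = 0"
    using f unfolding PBT_dual_def by blast
  let ?I = "{T :: unit tree. size T \<le> N}"
  \<comment> \<open>Equation \<open>T\<close> prescribes the value at
    \<open>PP (tree_star T)\<close>; indexed in this way the system is triangular for
    \<open>tree_key\<close>.\<close>
  have "\<exists>c. \<forall>T\<in>?I. (\<Sum>S\<in>?I. QQ' S (PP (tree_star T)) * c S) = f (PP (tree_star T))"
    using inj_on_subset[OF inj_tree_key] QQ'_PP_star_triangular
    by (intro triangular_system_solvable[where key = tree_key])
      (auto simp: finite_trees QQ'_PP_star_nonzero)
  then obtain c where c: "\<And>T. size T \<le> N \<Longrightarrow> (\<Sum>S\<in>?I. QQ' S (PP (tree_star T)) * c S) = f (PP (tree_star T))"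
    by auto
  define x where "x = (\<Sum>S\<in>?I. fscale (c S) (PP S :: 'k series))"
  have x: "x \<in> PBT" unfolding x_def PBT_def
    by (intro fun_vs.span_sum fun_vs.span_scale fun_vs.span_base) auto
  have x_tw: "x (tree_word T) = c T" if "size T \<le> N" for T
  proof -
    have "x (tree_word T) = (\<Sum>S\<in>?I. if S = T then c S else 0)"
      unfolding x_def sum_fun_apply by (intro sum.cong) (auto simp: PPd.dual)
    thus ?thesis using that finite_trees by simp
  qed
  have xN: "x w = 0" if "length w > N" for w
    unfolding x_def sum_fun_apply using that by (intro sum.neutral) (auto simp: PP_apply)
  \<comment> \<open>An injection of a finite set into itself is onto, so the equations cover every
    basis element up to degree \<open>N\<close>.\<close>
  have "tree_star ` ?I = ?I"
    using inj_on_subset[OF inj_tree_star] by (intro endo_inj_surj) (auto simp: finite_trees)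
  have "phi x (PP S) = f (PP S)" for S
  proof (cases "size S \<le> N")
    case True
    hence "S \<in> tree_star ` ?I" using \<open>tree_star ` ?I = ?I\<close> by auto
    then obtain T where T: "size T \<le> N" "S = tree_star T" by auto
    have "phi x (PP S) = (\<Sum>S'\<in>?I. x (tree_word S') * QQ' S' (PP S))" by (rule phi_at_PP_expand[OF x xN])
    also have "\<dots> = (\<Sum>S'\<in>?I. QQ' S' (PP (tree_star T)) * c S')"
      using T(2) x_tw by (intro sum.cong) (auto simp: mult.commute)
    also have "\<dots> = f (PP S)" using c T by simp
    finally show ?thesis .
  next
    case False
    have "PP S \<in> PBT_deg (size S)" unfolding PBT_deg_def by (intro fun_vs.span_base) auto
    hence "f (PP S) = 0" using N False by (meson not_le)
    moreover have "phi x (PP S) = 0" using False xN x by (auto simp: phi_at_PP QQ'_apply intro!: sum.neutral)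
    ultimately show ?thesis by simp
  qed
  moreover have "phi x \<in> PBT_dual" by (rule phi_in_PBT_dual[OF x])
  ultimately have "phi x = f"
    using f unfolding PBT_dual_def by (intro PBT_forms_eqI) auto
  thus ?thesis using x by blast
qed

lemma bij_betw_phi: "bij_betw (phi :: 'k::field_char_0 series \<Rightarrow> 'k form) PBT PBT_dual"
  unfolding bij_betw_def
proof
  show "inj_on (phi :: 'k series \<Rightarrow> 'k form) PBT"
  proof (rule inj_onI)
    fix x y :: "'k series" assume xy: "x \<in> PBT" "y \<in> PBT" "phi x = phi y"
    \<comment> \<open>The difference is formed by addition and scaling, the operations for which
      linearity is stated.\<close>
    let ?z = "fscale (- 1) y"
    have z: "?z \<in> PBT" using xy(2) by (rule PBT_closed(2))
    have "phi (x + ?z) = phi x + fscale (- 1) (phi y)"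
      using linear_on_phi xy z unfolding linear_on_def by metis
    hence "phi (x + ?z) = 0" using xy(3) by (simp add: fun_eq_iff)
    hence "x + ?z = 0" using xy z by (intro phi_eq_0 PBT_closed(1))
    thus "x = y" by (simp add: fun_eq_iff)
  qed
  show "phi ` PBT = (PBT_dual :: 'k form set)"
    using phi_in_PBT_dual phi_surj by blast
qed

theorem mainTheorem15:
  shows "linear_on fscale PBT (phi :: 'k::field_char_0 series \<Rightarrow> 'k form) \<and>
    (\<forall>T. phi (PP T :: 'k series) = QQ' T) \<and>
    bij_betw (phi :: 'k series \<Rightarrow> 'k form) PBT PBT_dual \<and>
    (\<forall>T' T''. phi ((PP T' :: 'k series) \<odot> PP T'') = QQ' T' \<star> QQ' T'') \<and>
    (\<forall>T. tensor_map phi phi (coprod (PP T :: 'k series)) = dual_coprod (QQ' T)) \<and>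
    phi (series_one :: 'k series) = dual_one \<and>
    (\<forall>x \<in> (PBT :: 'k series set). dual_counit (phi x) = counit x)"
  using linear_on_phi phi_PP bij_betw_phi phi_mult tensor_map_phi_coprod phi_series_one dual_counit_phi
  by blast

end
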